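(* Let $\gamma>0$, let $\Omega\subset\mathbb{R}^N$ be a bounded smooth domain, and let $f:[0,\infty)\to\mathbb{R}$ be locally Lipschitz continuous and non-decreasing, with $f(s)>0$ for $s>0$ and $f(0)\ge 0$. Let $u\in C(\overline{\Omega})\cap C^2(\Omega)$ be a solution to $$-\Delta u=\frac{1}{u^\gamma}+f(u)\ \text{ in }\Omega,\qquad u>0\ \text{ in }\Omega,\qquad u=0\ \text{ on }\partial\Omega ,$$ let $w=u-u_0$, and let $\nu\in\mathbb{R}^N$ with $|\nu|=1$. Then, for any $a(\nu)<\lambda<\lambda_1(\nu)$, we have $$w(x)<w_\lambda^\nu(x)\qquad\forall x\in\Omega_\lambda^\nu .$$ Moreover $$\frac{\partial w}{\partial\nu}(x)>0\qquad\forall x\in\Omega_{\lambda_1(\nu)}^\nu .$$ Finally, both conclusions hold true with $w$ replaced by $u$, that is, $u(x)<u_\lambda^\nu(x)$ for all $x\in\Omega_\lambda^\nu$ and all $a(\nu)<\lambda<\lambda_1(\nu)$, and $\frac{\partial u}{\partial\nu}(x)>0$ for all $x\in\Omega_{\lambda_1(\nu)}^\nu$.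
   Context: $u_0\in C(\overline\Omega)\cap C^2(\Omega)$ denotes the unique solution of $-\Delta u_0=u_0^{-\gamma}$ in $\Omega$, $u_0>0$ in $\Omega$, $u_0=0$ on $\partial\Omega$. It is known that $w=u-u_0\in H^1_0(\Omega)$, i.e. $u=u_0+w$ with $w\in H_0^1(\Omega)$. Notation: $\Omega_\lambda^\nu=\{x\in\Omega: x\cdot\nu<\lambda\}$; $x_\lambda^\nu=R_\lambda^\nu(x)=x+2(\lambda-x\cdot\nu)\nu$ is the reflection through the hyperplane $\{x\cdot\nu=\lambda\}$; $(\Omega_\lambda^\nu)'=R_\lambda^\nu(\Omega_\lambda^\nu)$; $a(\nu)=\inf_{x\in\Omega}x\cdot\nu$; $\lambda_1(\nu)=\sup\{\lambda>a(\nu): (\Omega_t^\nu)'\subset\Omega\text{ for all } a(\nu)<t\le\lambda\}$; $w_\lambda^\nu(x)=w(x_\lambda^\nu)$ and $u_\lambda^\nu(x)=u(x_\lambda^\nu)$. *)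

theory Defs
  imports "HOL-Analysis.Analysis"
begin

text \<open>Meant for open \<open>S\<close>: only then does \<open>frechet_derivative f (at x)\<close> depend on the values of
  \<open>f\<close> on \<open>S\<close> alone.\<close>

primrec Ck_on :: "nat \<Rightarrow> ('a::euclidean_space \<Rightarrow> real) \<Rightarrow> 'a set \<Rightarrow> bool" where
  "Ck_on 0 f S \<longleftrightarrow> continuous_on S f"
| "Ck_on (Suc k) f S \<longleftrightarrow>
     (\<forall>x\<in>S. f differentiable (at x)) \<and>
     (\<forall>i\<in>Basis. Ck_on k (\<lambda>x. frechet_derivative f (at x) i) S)"

definition smooth_on :: "('a::euclidean_space \<Rightarrow> real) \<Rightarrow> 'a set \<Rightarrow> bool" where
  "smooth_on f S \<longleftrightarrow> (\<forall>k. Ck_on k f S)"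

text \<open>The boundary is locally a smooth graph, in coordinates with vertical axis \<open>e\<close>, over the
  hyperplane orthogonal to \<open>e\<close>, and \<open>\<Omega>\<close> lies on one side of it.  The point
  \<open>x - (x \<bullet> e) *\<^sub>R e\<close> is the projection of \<open>x\<close> to that hyperplane, so only the
  restriction of \<open>g\<close> to the hyperplane matters.\<close>

definition bounded_smooth_domain :: "'a::euclidean_space set \<Rightarrow> bool" where
  "bounded_smooth_domain \<Omega> \<longleftrightarrow>
     open \<Omega> \<and> connected \<Omega> \<and> \<Omega> \<noteq> {} \<and> bounded \<Omega> \<and>
     (\<forall>p\<in>frontier \<Omega>. \<exists>r>0. \<exists>e g. norm e = 1 \<and> smooth_on g UNIV \<and>
        \<Omega> \<inter> ball p r = {x \<in> ball p r. x \<bullet> e > g (x - (x \<bullet> e) *\<^sub>R e)})"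

definition laplacian :: "('a::euclidean_space \<Rightarrow> real) \<Rightarrow> 'a \<Rightarrow> real" where
  "laplacian u x =
     (\<Sum>i\<in>Basis. frechet_derivative (\<lambda>y. frechet_derivative u (at y) i) (at x) i)"

text \<open>Classical positive solutions of \<open>-\<Delta>u = h(u)\<close> in \<open>\<Omega>\<close> with zero boundary values; values of
  \<open>u\<close> outside \<open>closure \<Omega>\<close> are irrelevant.\<close>

definition positive_dirichlet_solution ::
    "'a::euclidean_space set \<Rightarrow> (real \<Rightarrow> real) \<Rightarrow> ('a \<Rightarrow> real) \<Rightarrow> bool" where
  "positive_dirichlet_solution \<Omega> h u \<longleftrightarrow>
     continuous_on (closure \<Omega>) u \<and> Ck_on 2 u \<Omega> \<and>
     (\<forall>x\<in>\<Omega>. - laplacian u x = h (u x)) \<and>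
     (\<forall>x\<in>\<Omega>. u x > 0) \<and>
     (\<forall>x\<in>frontier \<Omega>. u x = 0)"

definition locally_lipschitz_on :: "real set \<Rightarrow> (real \<Rightarrow> real) \<Rightarrow> bool" where
  "locally_lipschitz_on S f \<longleftrightarrow> (\<forall>s\<in>S. \<exists>e>0. \<exists>L. L-lipschitz_on (cball s e \<inter> S) f)"

definition refl_hyp :: "'a::euclidean_space \<Rightarrow> real \<Rightarrow> 'a \<Rightarrow> 'a" where
  "refl_hyp \<nu> l x = x + (2 * (l - x \<bullet> \<nu>)) *\<^sub>R \<nu>"

definition cap :: "'a::euclidean_space set \<Rightarrow> 'a \<Rightarrow> real \<Rightarrow> 'a set" where
  "cap \<Omega> \<nu> l = {x \<in> \<Omega>. x \<bullet> \<nu> < l}"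

definition cap_start :: "'a::euclidean_space set \<Rightarrow> 'a \<Rightarrow> real" where
  "cap_start \<Omega> \<nu> = (INF x\<in>\<Omega>. x \<bullet> \<nu>)"

definition lambda1 :: "'a::euclidean_space set \<Rightarrow> 'a \<Rightarrow> real" where
  "lambda1 \<Omega> \<nu> =
     Sup {l. cap_start \<Omega> \<nu> < l \<and>
             (\<forall>t. cap_start \<Omega> \<nu> < t \<and> t \<le> l \<longrightarrow> refl_hyp \<nu> t ` cap \<Omega> \<nu> t \<subseteq> \<Omega>)}"

end

theory Submission
  imports Defs
begin

text \<open>The proof is the method of moving planes, carried out with classical barriers only.  Write
  \<open>w = u - u0\<close> and \<open>z = w\<^sub>\<lambda> - w\<close> on the cap at level \<open>\<lambda>\<close>.

  The singular nonlinearity is decreasing, so the maximum principle gives \<open>w > 0\<close> (\<open>w_pos\<close>) and, without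
  moving any plane, that \<open>u0\<close> is at most its reflection on every admissible cap (\<open>u0_le_reflection\<close>).
  The function \<open>(s + t) powr (- \<gamma>) - s powr (- \<gamma>)\<close> increases in \<open>s\<close> and decreases in \<open>t \<ge> 0\<close>.  With
  \<open>s = u0\<close> and \<open>t = w\<close> this shows that the singular terms never spoil the comparison:
  \<open>- \<Delta>z \<ge> L z\<close> where \<open>z < 0\<close>, with \<open>L\<close> a Lipschitz constant of \<open>f\<close> on the range of \<open>u\<close>
  (\<open>z_ineq_where_negative\<close>), and \<open>- \<Delta>z \<ge> - C z\<close> locally where \<open>z \<ge> 0\<close> (\<open>z_ineq_where_nonneg\<close>).

  The first inequality, together with exterior balls of comparable size at every small scale, excludes
  negative minima of \<open>z\<close> near the boundary of the cap (\<open>no_negative_min_near_exterior_ball\<close>,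
  \<open>uniform_exterior_balls\<close>).  No behaviour of \<open>w\<close> near the boundary beyond continuity is used.  The
  second inequality yields the strong maximum principle and the Hopf lemma, again from a Gaussian barrier
  (\<open>gauss_lower_bound_on_ball\<close>).  The cap need not be connected: a zero of \<open>z\<close> is instead propagated
  along a ray in direction \<open>- \<nu>\<close> to the boundary, where it contradicts the admissibility of slightly
  higher hyperplanes (\<open>z_pos\<close>).  A compactness argument at the first bad level then gives \<open>z \<ge> 0\<close>
  (\<open>z_nonneg_moving_planes\<close>), hence \<open>z > 0\<close>, below \<open>lambda1\<close>, and the Hopf lemma on the reflecting hyperplane gives
  the sign of the derivative of \<open>w\<close>.  The claims for \<open>u = u0 + w\<close> follow because \<open>u0\<close> satisfies the
  nonstrict ones.\<close>

section \<open>Gradients, Hessians and the second derivative test\<close>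

text \<open>\<open>G\<close> is the gradient field of \<open>u\<close> on \<open>S\<close>, and \<open>H x\<close> is the Hessian of \<open>u\<close> at \<open>x\<close>, as a linear
  endomorphism.  For open \<open>S\<close> only the values of the three functions on \<open>S\<close> matter; \<open>S\<close> may also be a
  single point, which expresses twofold differentiability there.\<close>

definition has_hessian_on ::
    "('a::euclidean_space \<Rightarrow> real) \<Rightarrow> ('a \<Rightarrow> 'a) \<Rightarrow> ('a \<Rightarrow> 'a \<Rightarrow> 'a) \<Rightarrow> 'a set \<Rightarrow> bool" where
  "has_hessian_on u G H S \<longleftrightarrow>
     (\<forall>x\<in>S. (u has_derivative (\<lambda>v. G x \<bullet> v)) (at x) \<and> (G has_derivative H x) (at x))"

text \<open>The trace of a linear endomorphism; the Laplacian is the trace of the Hessian.\<close>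

definition endo_trace :: "('a::euclidean_space \<Rightarrow> 'a) \<Rightarrow> real" where
  "endo_trace A = (\<Sum>i\<in>Basis. A i \<bullet> i)"

lemma has_hessian_onD:
  assumes "has_hessian_on u G H S" "x \<in> S"
  shows "(u has_derivative (\<lambda>v. G x \<bullet> v)) (at x)" "(G has_derivative H x) (at x)"
  using assms by (simp_all add: has_hessian_on_def)

lemma endo_trace_diff: "endo_trace (\<lambda>v. A v - B v) = endo_trace A - endo_trace B"
  by (simp add: endo_trace_def inner_diff_left sum_subtractf)

lemma endo_trace_scale: "endo_trace (\<lambda>v. c *\<^sub>R A v) = c * endo_trace A"
  by (simp add: endo_trace_def sum_distrib_left)

lemma has_hessian_on_subset: "has_hessian_on u G H S \<Longrightarrow> T \<subseteq> S \<Longrightarrow> has_hessian_on u G H T"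
  unfolding has_hessian_on_def by blast

lemma has_hessian_on_diff:
  assumes "has_hessian_on u G H S" "has_hessian_on v G' H' S"
  shows "has_hessian_on (\<lambda>x. u x - v x) (\<lambda>x. G x - G' x) (\<lambda>x h. H x h - H' x h) S"
  unfolding has_hessian_on_def
proof (intro ballI conjI)
  fix x assume "x \<in> S"
  with assms have D: "(u has_derivative (\<lambda>h. G x \<bullet> h)) (at x)" "(v has_derivative (\<lambda>h. G' x \<bullet> h)) (at x)"
    and D': "(G has_derivative H x) (at x)" "(G' has_derivative H' x) (at x)"
    unfolding has_hessian_on_def by auto
  show "((\<lambda>x. u x - v x) has_derivative (\<lambda>h. (G x - G' x) \<bullet> h)) (at x)"
    using has_derivative_diff[OF D] by (simp add: inner_diff_left)
  show "((\<lambda>x. G x - G' x) has_derivative (\<lambda>h. H x h - H' x h)) (at x)"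
    by (rule has_derivative_diff[OF D'])
qed

lemma has_hessian_on_scale:
  assumes "has_hessian_on u G H S"
  shows "has_hessian_on (\<lambda>x. c * u x) (\<lambda>x. c *\<^sub>R G x) (\<lambda>x h. c *\<^sub>R H x h) S"
  unfolding has_hessian_on_def
proof (intro ballI conjI)
  fix x assume "x \<in> S"
  with assms have D: "(u has_derivative (\<lambda>h. G x \<bullet> h)) (at x)" "(G has_derivative H x) (at x)"
    unfolding has_hessian_on_def by auto
  show "((\<lambda>x. c * u x) has_derivative (\<lambda>h. (c *\<^sub>R G x) \<bullet> h)) (at x)"
    using has_derivative_mult_right[OF D(1), of c] by simp
  show "((\<lambda>x. c *\<^sub>R G x) has_derivative (\<lambda>h. c *\<^sub>R H x h)) (at x)"
    by (rule has_derivative_scaleR_right[OF D(2)])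
qed

lemma has_hessian_on_continuous_on: "has_hessian_on u G H S \<Longrightarrow> continuous_on S u"
  by (rule continuous_at_imp_continuous_on)
    (auto dest!: has_hessian_onD(1) intro: has_derivative_continuous)

lemma linear_eq_sum_Basis:
  fixes A :: "'a::euclidean_space \<Rightarrow> 'b::real_vector"
  assumes "linear A"
  shows "A v = (\<Sum>i\<in>Basis. (v \<bullet> i) *\<^sub>R A i)"
proof -
  have "A v = A (\<Sum>i\<in>Basis. (v \<bullet> i) *\<^sub>R i)" by (simp add: euclidean_representation)
  also have "\<dots> = (\<Sum>i\<in>Basis. (v \<bullet> i) *\<^sub>R A i)"
    by (simp only: linear_sum[OF assms] linear_scale[OF assms])
  finally show ?thesis .
qed

lemma differentiable_has_gradient:
  fixes f :: "'a::euclidean_space \<Rightarrow> real"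
  assumes "f differentiable (at x)"
  shows "(f has_derivative (\<lambda>v. (\<Sum>i\<in>Basis. frechet_derivative f (at x) i *\<^sub>R i) \<bullet> v)) (at x)"
proof -
  let ?G = "\<Sum>i\<in>Basis. frechet_derivative f (at x) i *\<^sub>R i"
  have D: "(f has_derivative frechet_derivative f (at x)) (at x)"
    using assms frechet_derivative_works by blast
  have "frechet_derivative f (at x) v = ?G \<bullet> v" for v
    by (subst linear_eq_sum_Basis[OF has_derivative_linear[OF D]])
      (simp add: inner_sum_left inner_commute[of v] mult.commute)
  then have "frechet_derivative f (at x) = (\<lambda>v. ?G \<bullet> v)" by (rule ext)
  with D show ?thesis by simp
qed

lemma Ck_on_2_has_hessian_on:
  fixes u :: "'a::euclidean_space \<Rightarrow> real"
  assumes "Ck_on 2 u S"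
  obtains G H where "has_hessian_on u G H S" "\<And>x. x \<in> S \<Longrightarrow> endo_trace (H x) = laplacian u x"
proof
  let ?D = "\<lambda>i x. frechet_derivative u (at x) i"
  let ?G = "\<lambda>x. \<Sum>i\<in>Basis. ?D i x *\<^sub>R i"
  let ?H = "\<lambda>x v. \<Sum>i\<in>Basis. frechet_derivative (?D i) (at x) v *\<^sub>R i"
  have d1: "u differentiable (at x)" if "x \<in> S" for x
    using assms that by (simp add: numeral_2_eq_2)
  have d2: "?D i differentiable (at x)" if "x \<in> S" "i \<in> Basis" for x i
    using assms that by (simp add: numeral_2_eq_2)
  have "(u has_derivative (\<lambda>v. ?G x \<bullet> v)) (at x)" if "x \<in> S" for x
    by (rule differentiable_has_gradient[OF d1[OF that]])
  moreover have "(?G has_derivative ?H x) (at x)" if "x \<in> S" for x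
    by (intro has_derivative_sum has_derivative_scaleR_left)
      (use d2[OF that] frechet_derivative_works in blast)
  ultimately show "has_hessian_on u ?G ?H S"
    unfolding has_hessian_on_def by blast
  show "endo_trace (?H x) = laplacian u x" if "x \<in> S" for x
    unfolding endo_trace_def laplacian_def
    by (intro sum.cong refl) (simp add: inner_sum_left_Basis)
qed

text \<open>Applied to a reflection \<open>R\<close>, this is the invariance of the Laplacian under \<open>R\<close>; no symmetry of
  the Hessian is needed.\<close>

lemma endo_trace_conjugate_involution:
  fixes A :: "'a::euclidean_space \<Rightarrow> 'a"
  assumes A: "linear A" and sym: "\<And>v w. R v \<bullet> w = v \<bullet> R w" and inv: "\<And>v. R (R v) = v"
  shows "endo_trace (\<lambda>v. R (A (R v))) = endo_trace A"
proof -
  have swap: "R i \<bullet> j = R j \<bullet> i" for i j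
    using sym[of i j] by (simp add: inner_commute)
  have "endo_trace (\<lambda>v. R (A (R v))) = (\<Sum>i\<in>Basis. A (R i) \<bullet> R i)"
    by (simp add: endo_trace_def sym)
  also have "\<dots> = (\<Sum>i\<in>Basis. \<Sum>j\<in>Basis. (R i \<bullet> j) * (A j \<bullet> R i))"
    by (intro sum.cong refl, subst linear_eq_sum_Basis[OF A]) (simp add: inner_sum_left)
  also have "\<dots> = (\<Sum>j\<in>Basis. \<Sum>i\<in>Basis. (R j \<bullet> i) * (R (A j) \<bullet> i))"
    by (subst sum.swap) (intro sum.cong refl arg_cong2[where f="(*)"] swap sym[symmetric])
  also have "\<dots> = (\<Sum>j\<in>Basis. R j \<bullet> R (A j))"
    by (simp add: euclidean_inner[symmetric])
  also have "\<dots> = endo_trace A"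
    by (simp add: endo_trace_def sym inv inner_commute)
  finally show ?thesis .
qed

lemma has_real_derivative_along_line:
  fixes u :: "'a::real_inner \<Rightarrow> real"
  assumes "(u has_derivative (\<lambda>h. g \<bullet> h)) (at (x + t *\<^sub>R v))"
  shows "((\<lambda>s. u (x + s *\<^sub>R v)) has_real_derivative g \<bullet> v) (at t)"
proof -
  have line: "((\<lambda>s. x + s *\<^sub>R v) has_derivative (\<lambda>s. s *\<^sub>R v)) (at t)"
    by (auto intro!: derivative_eq_intros)
  show ?thesis
    by (rule has_derivative_imp_has_field_derivative[OF has_derivative_compose[OF line assms]]) simp
qed

lemma hessian_nonneg_at_local_min:
  fixes u :: "'a::euclidean_space \<Rightarrow> real"
  assumes hess: "has_hessian_on u G H S" and S: "open S" "x \<in> S"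
    and min: "\<And>y. y \<in> S \<Longrightarrow> u x \<le> u y"
  shows "H x v \<bullet> v \<ge> 0"
proof (rule ccontr)
  assume neg: "\<not> H x v \<bullet> v \<ge> 0"
  define \<phi> where "\<phi> t = u (x + t *\<^sub>R v)" for t
  define \<psi> where "\<psi> t = G (x + t *\<^sub>R v) \<bullet> v" for t
  have "open ((\<lambda>t. x + t *\<^sub>R v) -` S)"
    by (intro open_vimage S continuous_intros)
  moreover have "0 \<in> (\<lambda>t. x + t *\<^sub>R v) -` S" using S by simp
  ultimately obtain d where "d > 0" and dS: "ball 0 d \<subseteq> (\<lambda>t. x + t *\<^sub>R v) -` S"
    unfolding open_contains_ball by blast
  have inS: "x + t *\<^sub>R v \<in> S" if "\<bar>t\<bar> < d" for t
    using dS that by (auto simp: subset_eq)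
  have line: "((\<lambda>t. x + t *\<^sub>R v) has_derivative (\<lambda>s. s *\<^sub>R v)) (at t)" for t
    by (auto intro!: derivative_eq_intros)
  have D1: "(\<phi> has_real_derivative \<psi> t) (at t)" if "\<bar>t\<bar> < d" for t
    unfolding \<phi>_def \<psi>_def
    by (rule has_real_derivative_along_line[OF has_hessian_onD(1)[OF hess inS[OF that]]])
  have D2: "(\<psi> has_real_derivative H x v \<bullet> v) (at 0)"
  proof -
    have G: "(G has_derivative H x) (at (x + 0 *\<^sub>R v))"
      using has_hessian_onD(2)[OF hess S(2)] by simp
    from has_derivative_inner_left[OF has_derivative_compose[OF line G], of v]
    have "(\<psi> has_derivative (\<lambda>s. H x (s *\<^sub>R v) \<bullet> v)) (at 0)"
      by (simp only: \<psi>_def[abs_def])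
    then show ?thesis
      by (rule has_derivative_imp_has_field_derivative)
        (simp add: linear_scale[OF has_derivative_linear[OF G]])
  qed
  have min': "\<phi> 0 \<le> \<phi> t" if "\<bar>t\<bar> < d" for t
    using min[OF inS[OF that]] by (simp add: \<phi>_def)
  have \<psi>0: "\<psi> 0 = 0"
    by (rule DERIV_local_min[OF D1 \<open>d > 0\<close>]) (use \<open>d > 0\<close> min' in auto)
  obtain e where "e > 0" and e: "\<And>h. 0 < h \<Longrightarrow> h < e \<Longrightarrow> \<psi> h < \<psi> 0"
  proof -
    have "H x v \<bullet> v < 0" using neg by simp
    from DERIV_neg_dec_right[OF D2 this] show thesis using that by auto
  qed
  define t where "t = min d e / 2"
  have t: "0 < t" "t < d" "t < e" using \<open>d > 0\<close> \<open>e > 0\<close> by (auto simp: t_def min_def)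
  obtain s where s: "0 < s" "s < t" "\<phi> t - \<phi> 0 = (t - 0) * \<psi> s"
  proof -
    have "\<exists>s. 0 < s \<and> s < t \<and> \<phi> t - \<phi> 0 = (t - 0) * \<psi> s"
      by (rule MVT2) (use t D1 in auto)
    with that show thesis by blast
  qed
  have "\<psi> s < 0" using e[of s] s t \<psi>0 by simp
  then have "\<phi> t < \<phi> 0" using s t mult_pos_neg[of t "\<psi> s"] by simp
  with min'[of t] t show False by simp
qed

lemma trace_hessian_nonneg_at_local_min:
  fixes u :: "'a::euclidean_space \<Rightarrow> real"
  assumes "has_hessian_on u G H S" "open S" "x \<in> S" "\<And>y. y \<in> S \<Longrightarrow> u x \<le> u y"
  shows "endo_trace (H x) \<ge> 0"
  unfolding endo_trace_def using hessian_nonneg_at_local_min[OF assms] by (simp add: sum_nonneg)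

section \<open>Gaussian barriers and maximum principles\<close>

lemma has_hessian_on_gauss:
  fixes y :: "'a::euclidean_space" and \<alpha> c :: real
  defines "q \<equiv> \<lambda>x. exp (- \<alpha> * (norm (x - y))\<^sup>2)"
  shows "has_hessian_on (\<lambda>x. q x - c) (\<lambda>x. (- 2 * \<alpha> * q x) *\<^sub>R (x - y))
    (\<lambda>x v. (4 * \<alpha>\<^sup>2 * q x * ((x - y) \<bullet> v)) *\<^sub>R (x - y) - (2 * \<alpha> * q x) *\<^sub>R v) UNIV"
proof -
  have q: "(q has_derivative (\<lambda>v. (- 2 * \<alpha> * q x) *\<^sub>R (x - y) \<bullet> v)) (at x)" for x
  proof -
    have d: "((\<lambda>x. x - y) has_derivative (\<lambda>v. v)) (at x)"
      by (auto intro!: derivative_eq_intros)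
    have n: "((\<lambda>x. - \<alpha> * ((x - y) \<bullet> (x - y))) has_derivative (\<lambda>v. - \<alpha> * ((x - y) \<bullet> v + v \<bullet> (x - y)))) (at x)"
      by (rule has_derivative_mult_right[OF has_derivative_inner[OF d d]])
    have "(q has_derivative (\<lambda>v. q x * (- \<alpha> * ((x - y) \<bullet> v + v \<bullet> (x - y))))) (at x)"
      unfolding q_def power2_norm_eq_inner
      using has_derivative_exp[OF n] by (simp only: mult.commute)
    moreover have "q x * (- \<alpha> * ((x - y) \<bullet> v + v \<bullet> (x - y))) = (- 2 * \<alpha> * q x) *\<^sub>R (x - y) \<bullet> v" for v
      by (simp add: inner_commute[of v] mult.assoc)
    ultimately show ?thesis by (simp only:)
  qed
  have G: "((\<lambda>x. (- 2 * \<alpha> * q x) *\<^sub>R (x - y)) has_derivative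
     (\<lambda>v. (- 2 * \<alpha> * q x) *\<^sub>R v + (- 2 * \<alpha> * ((- 2 * \<alpha> * q x) *\<^sub>R (x - y) \<bullet> v)) *\<^sub>R (x - y))) (at x)" for x
  proof -
    have d: "((\<lambda>x. x - y) has_derivative (\<lambda>v. v)) (at x)"
      by (auto intro!: derivative_eq_intros)
    show ?thesis by (rule has_derivative_scaleR[OF has_derivative_mult_right[OF q] d])
  qed
  have H: "(\<lambda>v. (- 2 * \<alpha> * q x) *\<^sub>R v + (- 2 * \<alpha> * ((- 2 * \<alpha> * q x) *\<^sub>R (x - y) \<bullet> v)) *\<^sub>R (x - y))
     = (\<lambda>v. (4 * \<alpha>\<^sup>2 * q x * ((x - y) \<bullet> v)) *\<^sub>R (x - y) - (2 * \<alpha> * q x) *\<^sub>R v)" for x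
    by (rule ext) (simp add: power2_eq_square mult.assoc mult.left_commute)
  have "((\<lambda>x. q x - c) has_derivative (\<lambda>v. (- 2 * \<alpha> * q x) *\<^sub>R (x - y) \<bullet> v)) (at x)" for x
    using has_derivative_diff[OF q has_derivative_const] by simp
  then show ?thesis
    unfolding has_hessian_on_def by (intro ballI conjI G[unfolded H])
qed

lemma endo_trace_gauss:
  fixes y :: "'a::euclidean_space"
  shows "endo_trace (\<lambda>v. (4 * \<alpha>\<^sup>2 * e * ((x - y) \<bullet> v)) *\<^sub>R (x - y) - (2 * \<alpha> * e) *\<^sub>R v)
    = e * (4 * \<alpha>\<^sup>2 * (norm (x - y))\<^sup>2 - 2 * \<alpha> * DIM('a))"
proof -
  have "(norm (x - y))\<^sup>2 = (\<Sum>i\<in>Basis. ((x - y) \<bullet> i) * ((x - y) \<bullet> i))"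
    by (simp add: power2_norm_eq_inner euclidean_inner[symmetric])
  moreover have "endo_trace (\<lambda>v. (4 * \<alpha>\<^sup>2 * e * ((x - y) \<bullet> v)) *\<^sub>R (x - y) - (2 * \<alpha> * e) *\<^sub>R v)
     = (4 * \<alpha>\<^sup>2 * e) * (\<Sum>i\<in>Basis. ((x - y) \<bullet> i) * ((x - y) \<bullet> i)) - 2 * \<alpha> * e * DIM('a)"
    by (simp add: endo_trace_def inner_diff_left[of "_ *\<^sub>R _"] sum_subtractf sum_distrib_left
        mult.assoc inner_same_Basis)
  ultimately show ?thesis by (simp add: algebra_simps)
qed

text \<open>A replacement for the maximum principle in domains of small measure.  Suppose that
  \<open>z \<ge> 0\<close> on the boundary of \<open>D\<close> and \<open>- \<Delta>z \<ge> L z\<close> where \<open>z < 0\<close>, and let \<open>- m < 0\<close> be the minimum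
  of \<open>z\<close>.  If \<open>D\<close> misses the ball of radius \<open>\<kappa> R\<close> about \<open>y\<close>, then the Gaussian barrier \<open>q\<close>
  centred at \<open>y\<close>, which vanishes at distance \<open>R\<close>, has \<open>\<Delta>q > L\<close> on \<open>D \<inter> ball y R\<close> when \<open>R\<close> is small
  compared with \<open>\<kappa>\<close> and \<open>L\<close>, so that \<open>z + m \<ge> m q > 0\<close> there: the minimum is not attained within
  distance \<open>R\<close> of \<open>y\<close>.\<close>

lemma no_negative_min_near_exterior_ball:
  fixes z :: "'a::euclidean_space \<Rightarrow> real" and \<kappa> A :: real
  defines "A \<equiv> DIM('a) / \<kappa>\<^sup>2"
  assumes D: "bounded D" "open D"
    and cont: "continuous_on (closure D) z" and hess: "has_hessian_on z G H D"
    and bdry: "\<And>x. x \<in> frontier D \<Longrightarrow> z x \<ge> 0"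
    and ineq: "\<And>x. x \<in> D \<Longrightarrow> z x < 0 \<Longrightarrow> endo_trace (H x) \<le> - L * z x"
    and L: "L \<ge> 0" and \<kappa>: "\<kappa> > 0" and R: "R > 0"
    and small: "L * R\<^sup>2 < 2 * A * DIM('a) * exp (- A)"
    and min: "x0 \<in> D" "\<And>x. x \<in> closure D \<Longrightarrow> z x0 \<le> z x" and neg: "z x0 < 0"
    and ball: "ball y (\<kappa> * R) \<inter> D = {}" "dist y x0 < R"
  shows False
proof -
  define N where "N = real DIM('a)"
  have N: "N > 0" by (simp add: N_def)
  define m where "m = - z x0"
  have m: "m > 0" using neg by (simp add: m_def)
  \<comment> \<open>This makes \<open>\<alpha> r\<^sup>2\<close> lie between the dimension and \<open>A\<close> for \<open>\<kappa> R \<le> r \<le> R\<close>.\<close>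
  define \<alpha> where "\<alpha> = A / R\<^sup>2"
  have A: "A > 0" "A * \<kappa>\<^sup>2 = N" using \<kappa> N by (simp_all add: A_def N_def)
  have \<alpha>: "\<alpha> > 0" "\<alpha> * R\<^sup>2 = A" using A R by (simp_all add: \<alpha>_def)
  define q where "q x = exp (- \<alpha> * (norm (x - y))\<^sup>2) - exp (- \<alpha> * R\<^sup>2)" for x
  have q1: "q x \<le> 1" for x
  proof -
    have "exp (- \<alpha> * (norm (x - y))\<^sup>2) \<le> 1" using \<alpha> by simp
    then show ?thesis unfolding q_def by (smt (verit) exp_gt_zero)
  qed
  have q_pos: "q x > 0 \<longleftrightarrow> norm (x - y) < R" for x
  proof -
    have "q x > 0 \<longleftrightarrow> (norm (x - y))\<^sup>2 < R\<^sup>2" by (simp add: q_def \<open>\<alpha> > 0\<close>)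
    also have "\<dots> \<longleftrightarrow> norm (x - y) < R"
      using R by (auto intro: power2_less_imp_less power_strict_mono)
    finally show ?thesis .
  qed
  define g where "g x = z x - m * q x" for x
  let ?C = "closure D \<inter> cball y R"
  have "compact ?C" using D by (simp add: closed_Int_compact)
  moreover have x0: "x0 \<in> ?C" using min(1) ball(2) closure_subset by auto
  moreover have "continuous_on ?C g"
    unfolding g_def q_def
    by (intro continuous_intros continuous_on_subset[OF cont]) auto
  ultimately obtain x1 where x1: "x1 \<in> ?C" and min1: "\<And>x. x \<in> ?C \<Longrightarrow> g x1 \<le> g x"
    using continuous_attains_inf[of ?C g] by blast
  have "q x0 > 0" using q_pos ball(2) by (simp add: dist_norm norm_minus_commute)
  then have "m * q x0 > 0" using m by simp
  then have "g x0 < - m" by (simp add: g_def m_def)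
  then have g1: "g x1 < - m" using min1[OF x0] by simp
  have "z x1 \<ge> - m" using min(2) x1 by (simp add: m_def)
  with g1 have "m * q x1 > 0" by (simp add: g_def)
  then have r1: "norm (x1 - y) < R" using m q_pos by (simp add: zero_less_mult_iff)
  have "m * q x1 \<le> m" using q1[of x1] m by simp
  then have z1: "z x1 < 0" using g1 by (simp add: g_def)
  have x1D: "x1 \<in> D"
    using x1 bdry[of x1] z1 closure_Un_frontier[of D] by force
  have r1': "\<kappa> * R \<le> norm (x1 - y)"
    using ball(1) x1D by (force simp: dist_norm norm_minus_commute)
  define e where "e = exp (- \<alpha> * (norm (x1 - y))\<^sup>2)"
  have "has_hessian_on g
      (\<lambda>x. G x - m *\<^sub>R ((- 2 * \<alpha> * exp (- \<alpha> * (norm (x - y))\<^sup>2)) *\<^sub>R (x - y)))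
      (\<lambda>x h. H x h - m *\<^sub>R ((4 * \<alpha>\<^sup>2 * exp (- \<alpha> * (norm (x - y))\<^sup>2) * ((x - y) \<bullet> h)) *\<^sub>R (x - y)
         - (2 * \<alpha> * exp (- \<alpha> * (norm (x - y))\<^sup>2)) *\<^sub>R h)) (D \<inter> ball y R)"
    unfolding g_def q_def
    by (rule has_hessian_on_diff[OF has_hessian_on_subset[OF hess]
          has_hessian_on_scale[OF has_hessian_on_subset[OF has_hessian_on_gauss]]]) auto
  moreover have "open (D \<inter> ball y R)" using D by auto
  moreover have "x1 \<in> D \<inter> ball y R" using x1D r1 by (simp add: dist_norm norm_minus_commute)
  moreover have "g x1 \<le> g x" if "x \<in> D \<inter> ball y R" for x
  proof -
    have "x \<in> ?C" using that closure_subset by auto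
    then show ?thesis by (rule min1)
  qed
  ultimately have "endo_trace (\<lambda>h. H x1 h - m *\<^sub>R ((4 * \<alpha>\<^sup>2 * e * ((x1 - y) \<bullet> h)) *\<^sub>R (x1 - y) - (2 * \<alpha> * e) *\<^sub>R h)) \<ge> 0"
    unfolding e_def by (rule trace_hessian_nonneg_at_local_min)
  then have "m * (e * (4 * \<alpha>\<^sup>2 * (norm (x1 - y))\<^sup>2 - 2 * \<alpha> * N)) \<le> endo_trace (H x1)"
    by (simp only: endo_trace_diff[of "H x1"] endo_trace_scale[of m] endo_trace_gauss N_def
          diff_ge_0_iff_ge)
  also have "\<dots> \<le> L * (- z x1)" using ineq[OF x1D z1] by simp
  also have "\<dots> \<le> L * m"
    using \<open>z x1 \<ge> - m\<close> L by (intro mult_left_mono) auto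
  finally have e_le: "e * (4 * \<alpha>\<^sup>2 * (norm (x1 - y))\<^sup>2 - 2 * \<alpha> * N) \<le> L"
    using m by (simp add: mult.commute[of L])
  have "(\<kappa> * R)\<^sup>2 \<le> (norm (x1 - y))\<^sup>2"
    using r1' \<kappa> R by (intro power_mono) auto
  then have "\<alpha> * (\<kappa> * R)\<^sup>2 \<le> \<alpha> * (norm (x1 - y))\<^sup>2" using \<alpha> by simp
  moreover have "\<alpha> * (\<kappa> * R)\<^sup>2 = N"
    using \<alpha> A by (metis mult.assoc mult.commute power_mult_distrib)
  ultimately have "4 * \<alpha> * N \<le> 4 * \<alpha> * (\<alpha> * (norm (x1 - y))\<^sup>2)"
    using \<alpha> by simp
  moreover have "4 * \<alpha> * (\<alpha> * (norm (x1 - y))\<^sup>2) = 4 * \<alpha>\<^sup>2 * (norm (x1 - y))\<^sup>2"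
    by (simp add: power2_eq_square)
  ultimately have lo: "2 * \<alpha> * N \<le> 4 * \<alpha>\<^sup>2 * (norm (x1 - y))\<^sup>2 - 2 * \<alpha> * N"
    by linarith
  have "\<alpha> * (norm (x1 - y))\<^sup>2 \<le> \<alpha> * R\<^sup>2"
    using \<alpha> r1 by (intro mult_left_mono power_mono) auto
  then have "exp (- A) \<le> e" using \<alpha> by (simp add: e_def)
  then have "exp (- A) * (2 * \<alpha> * N) \<le> e * (4 * \<alpha>\<^sup>2 * (norm (x1 - y))\<^sup>2 - 2 * \<alpha> * N)"
    using lo \<alpha> N by (intro mult_mono) (auto simp: e_def)
  with e_le have "exp (- A) * (2 * \<alpha> * N) * R\<^sup>2 \<le> L * R\<^sup>2"
    by (intro mult_right_mono) auto
  moreover have "exp (- A) * (2 * \<alpha> * N) * R\<^sup>2 = exp (- A) * (2 * N) * (\<alpha> * R\<^sup>2)" by simp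
  then have "exp (- A) * (2 * \<alpha> * N) * R\<^sup>2 = 2 * A * DIM('a) * exp (- A)"
    unfolding \<alpha>(2) by (simp add: N_def)
  ultimately show False using small by simp
qed

text \<open>The barrier argument behind both the strong maximum principle (on the open ball the bound is
  positive) and the Hopf lemma (on the sphere the bound vanishes with nonzero slope).\<close>

lemma gauss_lower_bound_on_ball:
  fixes z :: "'a::euclidean_space \<Rightarrow> real"
  assumes \<rho>: "0 < \<rho>" "\<rho> < R"
    and cont: "continuous_on (cball y R) z" and hess: "has_hessian_on z G H (ball y R)"
    and nonneg: "\<And>x. x \<in> cball y R \<Longrightarrow> z x \<ge> 0"
    and pos: "\<And>x. x \<in> cball y \<rho> \<Longrightarrow> z x > 0"
    and C: "C \<ge> 0" and ineq: "\<And>x. x \<in> ball y R \<Longrightarrow> endo_trace (H x) \<le> C * z x"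
  obtains \<eta> \<alpha> where "\<eta> > 0" "\<alpha> > 0"
    "\<And>x. x \<in> cball y R \<Longrightarrow> \<eta> * (exp (- \<alpha> * (norm (x - y))\<^sup>2) - exp (- \<alpha> * R\<^sup>2)) \<le> z x"
proof -
  define N where "N = real DIM('a)"
  have N: "N > 0" by (simp add: N_def)
  have "continuous_on (cball y \<rho>) z" by (rule continuous_on_subset[OF cont]) (use \<rho> in auto)
  then obtain xm where xm: "xm \<in> cball y \<rho>" "\<And>x. x \<in> cball y \<rho> \<Longrightarrow> z xm \<le> z x"
    using continuous_attains_inf[of "cball y \<rho>" z] \<rho> by (auto simp del: mem_cball)
  \<comment> \<open>Since \<open>q \<le> 1\<close>, the bound holds on the small ball for this \<open>\<eta>\<close>; the choice of \<open>\<alpha>\<close> makes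
    \<open>\<Delta>q > C q\<close> outside of it.\<close>
  define \<eta> where "\<eta> = z xm"
  have \<eta>: "\<eta> > 0" using pos xm by (simp add: \<eta>_def)
  define \<alpha> where "\<alpha> = (N + C) / \<rho>\<^sup>2 + 1"
  have \<alpha>: "\<alpha> \<ge> 1" "\<alpha> * \<rho>\<^sup>2 \<ge> N + C" using N C \<rho> by (simp_all add: \<alpha>_def field_simps)
  then have "\<alpha> > 0" by simp
  define q where "q x = exp (- \<alpha> * (norm (x - y))\<^sup>2) - exp (- \<alpha> * R\<^sup>2)" for x
  have q_le: "q x \<le> exp (- \<alpha> * (norm (x - y))\<^sup>2)" for x
    by (simp add: q_def)
  have q1: "q x \<le> 1" for x
  proof -
    have "exp (- \<alpha> * (norm (x - y))\<^sup>2) \<le> 1" using \<alpha> by simp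
    then show ?thesis using q_le[of x] by linarith
  qed
  have q_pos: "q x > 0 \<longleftrightarrow> norm (x - y) < R" for x
  proof -
    have "q x > 0 \<longleftrightarrow> (norm (x - y))\<^sup>2 < R\<^sup>2" by (simp add: q_def \<open>\<alpha> > 0\<close>)
    also have "\<dots> \<longleftrightarrow> norm (x - y) < R"
      using \<rho> by (auto intro: power2_less_imp_less power_strict_mono)
    finally show ?thesis .
  qed
  define g where "g x = z x - \<eta> * q x" for x
  have "continuous_on (cball y R) g"
    unfolding g_def q_def by (intro continuous_intros cont)
  then obtain x1 where x1: "x1 \<in> cball y R" and min1: "\<And>x. x \<in> cball y R \<Longrightarrow> g x1 \<le> g x"
    using continuous_attains_inf[of "cball y R" g] \<rho> by (auto simp del: mem_cball)
  have "g x1 \<ge> 0"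
  proof (rule ccontr)
    assume "\<not> g x1 \<ge> 0"
    then have z1: "z x1 < \<eta> * q x1" by (simp add: g_def)
    then have "q x1 > 0" using nonneg[OF x1] \<eta> by (smt (verit) zero_less_mult_iff)
    then have r1: "norm (x1 - y) < R" using q_pos by simp
    have "\<eta> * q x1 \<le> \<eta>" using q1[of x1] \<eta> by simp
    then have "x1 \<notin> cball y \<rho>" using xm(2)[of x1] z1 by (auto simp: \<eta>_def)
    then have r1': "\<rho> \<le> norm (x1 - y)" by (simp add: dist_norm norm_minus_commute)
    define e where "e = exp (- \<alpha> * (norm (x1 - y))\<^sup>2)"
    have "has_hessian_on g
        (\<lambda>x. G x - \<eta> *\<^sub>R ((- 2 * \<alpha> * exp (- \<alpha> * (norm (x - y))\<^sup>2)) *\<^sub>R (x - y)))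
        (\<lambda>x h. H x h - \<eta> *\<^sub>R ((4 * \<alpha>\<^sup>2 * exp (- \<alpha> * (norm (x - y))\<^sup>2) * ((x - y) \<bullet> h)) *\<^sub>R (x - y)
           - (2 * \<alpha> * exp (- \<alpha> * (norm (x - y))\<^sup>2)) *\<^sub>R h)) (ball y R)"
      unfolding g_def q_def
      by (rule has_hessian_on_diff[OF hess
            has_hessian_on_scale[OF has_hessian_on_subset[OF has_hessian_on_gauss]]]) auto
    moreover have "open (ball y R)" by simp
    moreover have "x1 \<in> ball y R" using r1 by (simp add: dist_norm norm_minus_commute)
    moreover have "g x1 \<le> g x" if "x \<in> ball y R" for x
    proof -
      have "x \<in> cball y R" using that by auto
      then show ?thesis by (rule min1)
    qed
    ultimately have "endo_trace (\<lambda>h. H x1 h - \<eta> *\<^sub>R ((4 * \<alpha>\<^sup>2 * e * ((x1 - y) \<bullet> h)) *\<^sub>R (x1 - y) - (2 * \<alpha> * e) *\<^sub>R h)) \<ge> 0"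
      unfolding e_def by (rule trace_hessian_nonneg_at_local_min)
    then have "\<eta> * (e * (4 * \<alpha>\<^sup>2 * (norm (x1 - y))\<^sup>2 - 2 * \<alpha> * N)) \<le> endo_trace (H x1)"
      by (simp only: endo_trace_diff[of "H x1"] endo_trace_scale[of \<eta>] endo_trace_gauss N_def
          diff_ge_0_iff_ge)
    also have "\<dots> \<le> C * z x1" using ineq r1 by (simp add: dist_norm norm_minus_commute)
    also have "\<dots> \<le> C * (\<eta> * e)"
    proof -
      have "\<eta> * q x1 \<le> \<eta> * e" using q_le[of x1] \<eta> by (simp add: e_def)
      with z1 show ?thesis using C by (intro mult_left_mono) auto
    qed
    finally have "(\<eta> * e) * (4 * \<alpha>\<^sup>2 * (norm (x1 - y))\<^sup>2 - 2 * \<alpha> * N) \<le> (\<eta> * e) * C"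
      by (simp add: mult.assoc mult.commute mult.left_commute)
    moreover have "\<eta> * e > 0" using \<eta> by (simp add: e_def)
    ultimately have le: "4 * \<alpha>\<^sup>2 * (norm (x1 - y))\<^sup>2 - 2 * \<alpha> * N \<le> C"
      by (simp only: mult_le_cancel_left_pos)
    have "\<rho>\<^sup>2 \<le> (norm (x1 - y))\<^sup>2" using r1' \<rho> by (intro power_mono) auto
    then have "\<alpha> * \<rho>\<^sup>2 \<le> \<alpha> * (norm (x1 - y))\<^sup>2" using \<alpha> by (intro mult_left_mono) auto
    then have "N + 2 * C \<le> 2 * (\<alpha> * (norm (x1 - y))\<^sup>2) - N" using \<alpha> N C by linarith
    then have "(2 * 1) * (N + 2 * C) \<le> (2 * \<alpha>) * (2 * (\<alpha> * (norm (x1 - y))\<^sup>2) - N)"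
      using \<alpha> N C by (intro mult_mono) auto
    also have "\<dots> = 4 * \<alpha>\<^sup>2 * (norm (x1 - y))\<^sup>2 - 2 * \<alpha> * N"
      by (simp add: power2_eq_square algebra_simps)
    also have "\<dots> \<le> C" by (rule le)
    finally show False using N C by simp
  qed
  show thesis
  proof (rule that[OF \<eta>, of \<alpha>])
    show "\<alpha> > 0" using \<alpha> by simp
    fix x assume "x \<in> cball y R"
    from min1[OF this] \<open>g x1 \<ge> 0\<close>
    show "\<eta> * (exp (- \<alpha> * (norm (x - y))\<^sup>2) - exp (- \<alpha> * R\<^sup>2)) \<le> z x"
      by (simp add: g_def q_def)
  qed
qed

section \<open>Geometry of smooth domains\<close>

lemma smooth_on_gradient:
  fixes g :: "'a::euclidean_space \<Rightarrow> real"
  assumes "smooth_on g UNIV"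
  obtains G where "\<And>x. (g has_derivative (\<lambda>v. G x \<bullet> v)) (at x)" "continuous_on UNIV G"
proof
  let ?D = "\<lambda>i x. frechet_derivative g (at x) i"
  let ?G = "\<lambda>x. \<Sum>i\<in>Basis. ?D i x *\<^sub>R i"
  have C1: "Ck_on (Suc 0) g UNIV" using assms unfolding smooth_on_def by blast
  show "(g has_derivative (\<lambda>v. ?G x \<bullet> v)) (at x)" for x
    by (rule differentiable_has_gradient) (use C1 in simp)
  have "continuous_on UNIV (?D i)" if "i \<in> Basis" for i
    using C1 that by simp
  then show "continuous_on UNIV ?G"
    by (intro continuous_on_sum continuous_on_scaleR continuous_on_const)
qed

text \<open>A boundary chart \<open>x \<bullet> e > g (x - (x \<bullet> e) *\<^sub>R e)\<close> as the superlevel set of a function \<open>\<phi>\<close> with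
  continuous gradient \<open>F\<close>.\<close>

lemma defining_function_at_frontier:
  fixes \<Omega> :: "'a::euclidean_space set"
  assumes dom: "bounded_smooth_domain \<Omega>" and p: "p \<in> frontier \<Omega>"
  obtains r e \<phi> F where "r > 0" "norm e = 1"
    "\<And>x. (\<phi> has_derivative (\<lambda>v. F x \<bullet> v)) (at x)" "continuous_on UNIV F"
    "\<And>x t. \<phi> (x + t *\<^sub>R e) = \<phi> x + t" "\<And>x. F x \<bullet> e = 1"
    "\<And>x. x \<in> ball p r \<Longrightarrow> x \<in> \<Omega> \<longleftrightarrow> \<phi> x > 0"
    "\<And>x. x \<in> ball p r \<Longrightarrow> x \<in> frontier \<Omega> \<Longrightarrow> \<phi> x = 0"
proof -
  obtain r e g where r: "r > 0" and e: "norm e = 1" and g: "smooth_on g UNIV"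
    and \<Omega>: "\<Omega> \<inter> ball p r = {x \<in> ball p r. x \<bullet> e > g (x - (x \<bullet> e) *\<^sub>R e)}"
    using dom p unfolding bounded_smooth_domain_def by blast
  have op: "open \<Omega>" using dom unfolding bounded_smooth_domain_def by blast
  have ee: "e \<bullet> e = 1" using e by (simp add: norm_eq_1)
  obtain G where G: "\<And>x. (g has_derivative (\<lambda>v. G x \<bullet> v)) (at x)" and Gc: "continuous_on UNIV G"
    using smooth_on_gradient[OF g] by blast
  define P where "P x = x - (x \<bullet> e) *\<^sub>R e" for x
  define \<phi> where "\<phi> x = x \<bullet> e - g (P x)" for x
  define F where "F x = e - P (G (P x))" for x
  have Pe: "P (x + t *\<^sub>R e) = P x" for x t
    by (simp add: P_def inner_add_left ee algebra_simps)
  have Psym: "P v \<bullet> w = v \<bullet> P w" for v w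
    by (simp add: P_def inner_diff_left inner_diff_right inner_commute)
  have dP: "(P has_derivative P) (at x)" for x
    unfolding P_def by (auto intro!: derivative_eq_intros)
  have D\<phi>: "(\<phi> has_derivative (\<lambda>v. F x \<bullet> v)) (at x)" for x
  proof -
    have "((\<lambda>x. x \<bullet> e - g (P x)) has_derivative (\<lambda>v. v \<bullet> e - G (P x) \<bullet> P v)) (at x)"
      by (intro has_derivative_diff has_derivative_compose[OF dP G] has_derivative_inner_left
          has_derivative_ident)
    moreover have "v \<bullet> e - G (P x) \<bullet> P v = F x \<bullet> v" for v
      unfolding F_def inner_diff_left Psym by (simp add: inner_commute[of v e])
    ultimately show ?thesis by (simp add: \<phi>_def[abs_def])
  qed
  have \<phi>e: "\<phi> (x + t *\<^sub>R e) = \<phi> x + t" for x t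
    by (simp add: \<phi>_def Pe inner_add_left ee)
  have Fe: "F x \<bullet> e = 1" for x
  proof -
    have "P e = 0" by (simp add: P_def ee)
    then show ?thesis by (simp add: F_def inner_diff_left Psym ee)
  qed
  have Pc: "continuous_on S P" for S unfolding P_def by (intro continuous_intros)
  have Fc: "continuous_on UNIV F"
    unfolding F_def
    by (intro continuous_intros continuous_on_compose2[OF Pc] continuous_on_compose2[OF Gc] Pc) auto
  have chart: "x \<in> \<Omega> \<longleftrightarrow> \<phi> x > 0" if "x \<in> ball p r" for x
  proof -
    have "x \<in> \<Omega> \<inter> ball p r \<longleftrightarrow> x \<in> {x \<in> ball p r. x \<bullet> e > g (x - (x \<bullet> e) *\<^sub>R e)}"
      by (simp only: \<Omega>)
    with that show ?thesis by (simp add: \<phi>_def P_def)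
  qed
  have \<phi>c: "continuous_on UNIV \<phi>"
    using D\<phi> by (auto intro!: continuous_at_imp_continuous_on has_derivative_continuous)
  have "\<phi> x = 0" if x: "x \<in> ball p r" "x \<in> frontier \<Omega>" for x
  proof (rule antisym)
    have "x \<notin> \<Omega>" using x(2) op by (simp add: frontier_def interior_open)
    then show "\<phi> x \<le> 0" using chart[OF x(1)] by simp
    show "\<phi> x \<ge> 0"
    proof (rule ccontr)
      assume "\<not> \<phi> x \<ge> 0"
      let ?U = "\<phi> -` {..<0} \<inter> ball p r"
      have "open ?U" using \<phi>c by (intro open_Int open_ball) (simp add: continuous_on_open_vimage)
      moreover have "?U \<inter> \<Omega> = {}" using chart by force
      ultimately have "?U \<inter> closure \<Omega> = {}" using open_Int_closure_eq_empty by blast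
      moreover have "x \<in> ?U \<inter> closure \<Omega>"
        using x \<open>\<not> \<phi> x \<ge> 0\<close> by (simp add: frontier_def)
      ultimately show False by blast
    qed
  qed
  from that[OF r e D\<phi> Fc \<phi>e Fe chart this] show thesis by blast
qed

lemma exterior_balls_near_point:
  fixes \<Omega> :: "'a::euclidean_space set"
  assumes dom: "bounded_smooth_domain \<Omega>" and p: "p \<in> frontier \<Omega>"
  obtains \<kappa> \<rho> where "\<kappa> > 0" "\<rho> > 0"
    "\<And>p' R. p' \<in> frontier \<Omega> \<Longrightarrow> dist p p' < \<rho> \<Longrightarrow> 0 < R \<Longrightarrow> R < \<rho> \<Longrightarrow>
       \<exists>y. dist y p' \<le> R / 2 \<and> ball y (\<kappa> * R) \<inter> \<Omega> = {}"
proof -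
  obtain r e \<phi> F where r: "r > 0" and e: "norm e = 1"
    and D\<phi>: "\<And>x. (\<phi> has_derivative (\<lambda>v. F x \<bullet> v)) (at x)" and Fc: "continuous_on UNIV F"
    and \<phi>e: "\<And>x t. \<phi> (x + t *\<^sub>R e) = \<phi> x + t"
    and chart: "\<And>x. x \<in> ball p r \<Longrightarrow> x \<in> \<Omega> \<longleftrightarrow> \<phi> x > 0"
    and \<phi>0: "\<And>x. x \<in> ball p r \<Longrightarrow> x \<in> frontier \<Omega> \<Longrightarrow> \<phi> x = 0"
    using defining_function_at_frontier[OF assms] by metis
  have "compact (F ` cball p r)"
    by (intro compact_continuous_image continuous_on_subset[OF Fc]) auto
  then obtain B where B: "B > 0" "\<And>x. x \<in> cball p r \<Longrightarrow> norm (F x) \<le> B"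
    using compact_imp_bounded bounded_pos by (metis image_eqI)
  have lip: "\<phi> x \<le> \<phi> y + B * norm (x - y)" if "x \<in> cball p r" "y \<in> cball p r" for x y
  proof -
    have "norm (\<phi> x - \<phi> y) \<le> B * norm (x - y)"
    proof (rule differentiable_bound[where S = "cball p r"])
      show "(\<phi> has_derivative (\<lambda>v. F x \<bullet> v)) (at x within cball p r)" for x
        by (rule has_derivative_at_withinI[OF D\<phi>])
      show "onorm (\<lambda>v. F x \<bullet> v) \<le> B" if "x \<in> cball p r" for x
      proof (rule onorm_le)
        fix v
        have "norm (F x \<bullet> v) \<le> norm (F x) * norm v" by (simp add: Cauchy_Schwarz_ineq2)
        also have "\<dots> \<le> B * norm v" using B(2)[OF that] by (intro mult_right_mono) auto
        finally show "norm (F x \<bullet> v) \<le> B * norm v" .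
      qed
    qed (use that in auto)
    then show ?thesis by auto
  qed
  \<comment> \<open>\<open>\<phi>\<close> is \<open>- R / 2\<close> at \<open>p' - (R / 2) *\<^sub>R e\<close> and has Lipschitz constant \<open>B\<close>, so it stays
    nonpositive within distance \<open>\<kappa> * R\<close> of that point.\<close>
  define \<kappa> where "\<kappa> = 1 / (2 * (1 + B))"
  have \<kappa>: "\<kappa> > 0" "\<kappa> \<le> 1 / 2" "B * \<kappa> \<le> 1 / 2"
    using B by (simp_all add: \<kappa>_def field_simps)
  show thesis
  proof (rule that[of \<kappa> "r / 4"])
    show "\<kappa> > 0" "r / 4 > 0" using \<kappa> r by auto
    fix p' R assume p': "p' \<in> frontier \<Omega>" "dist p p' < r / 4" and R: "0 < R" "R < r / 4"
    define y where "y = p' + (- (R / 2)) *\<^sub>R e"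
    have dy: "dist y p' = R / 2" using e R by (simp add: y_def dist_norm)
    have "\<phi> p' = 0" using \<phi>0 p' r by auto
    then have \<phi>y: "\<phi> y = - (R / 2)" by (simp only: y_def \<phi>e)
    have "x \<notin> \<Omega>" if "x \<in> ball y (\<kappa> * R)" for x
    proof -
      have xy: "dist y x < \<kappa> * R" using that by simp
      have "\<kappa> * R \<le> 1 / 2 * R" using \<kappa> R by (intro mult_right_mono) auto
      then have "dist y x < R / 2" using xy by simp
      moreover have "dist p' y = R / 2" using dy by (simp only: dist_commute)
      ultimately have "dist p x < r" "dist p y < r"
        using p' R dist_triangle[of p x p'] dist_triangle[of p' x y] dist_triangle[of p y p']
        by linarith+
      then have "\<phi> x \<le> \<phi> y + B * norm (x - y)" by (intro lip) auto
      also have "B * norm (x - y) \<le> B * (\<kappa> * R)"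
        using xy B by (intro mult_left_mono) (auto simp: dist_norm norm_minus_commute)
      also have "B * (\<kappa> * R) \<le> 1 / 2 * R"
        using mult_right_mono[OF \<kappa>(3), of R] R by (simp add: mult.assoc)
      finally have "\<phi> x \<le> 0" using \<phi>y by simp
      then show ?thesis using chart[of x] \<open>dist p x < r\<close> by auto
    qed
    then show "\<exists>y. dist y p' \<le> R / 2 \<and> ball y (\<kappa> * R) \<inter> \<Omega> = {}"
      using dy by (intro exI[of _ y]) auto
  qed
qed

text \<open>The complement of the domain contains, at every boundary point and every small scale \<open>R\<close>, a
  ball of radius \<open>\<kappa> R\<close> centred within distance \<open>R / 2\<close>; this is all that the maximum principle
  near the boundary requires.\<close>

lemma uniform_exterior_balls:
  fixes \<Omega> :: "'a::euclidean_space set"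
  assumes dom: "bounded_smooth_domain \<Omega>"
  obtains \<kappa> \<rho> where "\<kappa> > 0" "\<kappa> \<le> 1 / 4" "\<rho> > 0"
    "\<And>p R. p \<in> frontier \<Omega> \<Longrightarrow> 0 < R \<Longrightarrow> R < \<rho> \<Longrightarrow>
       \<exists>y. dist y p \<le> R / 2 \<and> ball y (\<kappa> * R) \<inter> \<Omega> = {}"
proof -
  let ?P = "\<lambda>\<kappa> R p. \<exists>y. dist y p \<le> R / 2 \<and> ball y (\<kappa> * R) \<inter> \<Omega> = {}"
  have "\<exists>n::nat. \<forall>p\<in>frontier \<Omega>. \<forall>R. 0 < R \<longrightarrow> R < inverse (real (Suc n)) \<longrightarrow> ?P (inverse (real (Suc n))) R p"
  proof (rule ccontr)
    assume "\<not> ?thesis"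
    then have "\<forall>n. \<exists>p R. p \<in> frontier \<Omega> \<and> 0 < R \<and> R < inverse (real (Suc n)) \<and> \<not> ?P (inverse (real (Suc n))) R p"
      by blast
    then obtain p R where pR: "\<And>n. p n \<in> frontier \<Omega>" "\<And>n. 0 < R n" "\<And>n. R n < inverse (real (Suc n))"
       "\<And>n. \<not> ?P (inverse (real (Suc n))) (R n) (p n)"
      by metis
    have "compact (frontier \<Omega>)"
      using dom unfolding bounded_smooth_domain_def by (simp add: compact_frontier_bounded)
    then obtain q s where q: "q \<in> frontier \<Omega>" and s: "strict_mono s" "(p \<circ> s) \<longlonglongrightarrow> q"
      using pR(1) unfolding compact_def by metis
    obtain \<kappa> \<rho> where \<kappa>: "\<kappa> > 0" and \<rho>: "\<rho> > 0"
      and near: "\<And>p' R. p' \<in> frontier \<Omega> \<Longrightarrow> dist q p' < \<rho> \<Longrightarrow> 0 < R \<Longrightarrow> R < \<rho> \<Longrightarrow> ?P \<kappa> R p'"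
      using exterior_balls_near_point[OF dom q] by metis
    have "(\<lambda>n. inverse (real (Suc n))) \<longlonglongrightarrow> 0" by (rule LIMSEQ_inverse_real_of_nat)
    then have "((\<lambda>n. inverse (real (Suc n))) \<circ> s) \<longlonglongrightarrow> 0" by (rule LIMSEQ_subseq_LIMSEQ[OF _ s(1)])
    then have "\<forall>\<^sub>F n in sequentially. inverse (real (Suc (s n))) < min \<kappa> \<rho>"
      using \<kappa> \<rho> order_tendstoD(2)[of _ 0 sequentially "min \<kappa> \<rho>"] by (simp add: o_def)
    moreover have "\<forall>\<^sub>F n in sequentially. dist (p (s n)) q < \<rho>"
      using s(2) \<rho> tendstoD[of "p \<circ> s" q sequentially \<rho>] by (simp add: o_def)
    ultimately have "\<forall>\<^sub>F n in sequentially. inverse (real (Suc (s n))) < min \<kappa> \<rho> \<and> dist (p (s n)) q < \<rho>"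
      by eventually_elim simp
    then obtain n where n: "inverse (real (Suc (s n))) < min \<kappa> \<rho>" "dist (p (s n)) q < \<rho>"
      using eventually_happens'[OF sequentially_bot] by blast
    have "?P \<kappa> (R (s n)) (p (s n))"
      by (rule near) (use n pR(1)[of "s n"] pR(2)[of "s n"] pR(3)[of "s n"] in \<open>auto simp: dist_commute\<close>)
    then obtain y where y: "dist y (p (s n)) \<le> R (s n) / 2" "ball y (\<kappa> * R (s n)) \<inter> \<Omega> = {}" by blast
    have "inverse (real (Suc (s n))) * R (s n) \<le> \<kappa> * R (s n)"
      using n pR(2)[of "s n"] by (intro mult_right_mono) auto
    then have "ball y (inverse (real (Suc (s n))) * R (s n)) \<inter> \<Omega> = {}"
      using y(2) subset_ball by blast
    with y(1) pR(4)[of "s n"] show False by blast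
  qed
  then obtain n :: nat where n: "\<And>p R. p \<in> frontier \<Omega> \<Longrightarrow> 0 < R \<Longrightarrow> R < inverse (real (Suc n)) \<Longrightarrow> ?P (inverse (real (Suc n))) R p"
    by blast
  let ?i = "inverse (real (Suc n))"
  show thesis
  proof (rule that[of "min ?i (1 / 4)" ?i])
    fix p R assume "p \<in> frontier \<Omega>" and R: "0 < R" "R < ?i"
    then obtain y where y: "dist y p \<le> R / 2" "ball y (?i * R) \<inter> \<Omega> = {}" using n by blast
    have "min ?i (1 / 4) * R \<le> ?i * R" using R by (intro mult_right_mono) auto
    then have "ball y (min ?i (1 / 4) * R) \<inter> \<Omega> = {}" using y(2) subset_ball by blast
    with y(1) show "?P (min ?i (1 / 4)) R p" by blast
  qed auto
qed

lemma cap_start_le: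
  assumes "bounded \<Omega>" "x \<in> closure \<Omega>"
  shows "cap_start \<Omega> \<nu> \<le> x \<bullet> \<nu>"
proof -
  have "bounded ((\<lambda>x. x \<bullet> \<nu>) ` \<Omega>)"
    by (rule bounded_linear_image[OF assms(1) bounded_linear_inner_left])
  then have "\<And>x. x \<in> \<Omega> \<Longrightarrow> cap_start \<Omega> \<nu> \<le> x \<bullet> \<nu>"
    unfolding cap_start_def by (intro cINF_lower bounded_imp_bdd_below)
  then have "\<Omega> \<subseteq> {x. cap_start \<Omega> \<nu> \<le> x \<bullet> \<nu>}" by blast
  moreover have "closed {x. cap_start \<Omega> \<nu> \<le> x \<bullet> \<nu>}"
    by (intro closed_Collect_le continuous_intros)
  ultimately show ?thesis using assms(2) closure_minimal by blast
qed

lemma cap_start_less: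
  assumes "bounded \<Omega>" "open \<Omega>" "x \<in> \<Omega>" "norm \<nu> = 1"
  shows "cap_start \<Omega> \<nu> < x \<bullet> \<nu>"
proof -
  obtain r where r: "r > 0" "cball x r \<subseteq> \<Omega>" using assms open_contains_cball by blast
  have "x - r *\<^sub>R \<nu> \<in> cball x r" using r assms(4) by (simp add: dist_norm)
  then have "cap_start \<Omega> \<nu> \<le> (x - r *\<^sub>R \<nu>) \<bullet> \<nu>"
    using r closure_subset by (intro cap_start_le assms) blast
  also have "\<dots> < x \<bullet> \<nu>" using r assms(4) by (simp add: inner_diff_left norm_eq_1)
  finally show ?thesis .
qed

text \<open>The supremum that defines \<open>lambda1\<close> is taken over a nonempty set.  Points of caps that shrink to
  the supporting hyperplane accumulate at a boundary point \<open>p\<close> with \<open>p \<bullet> \<nu> = cap_start \<Omega> \<nu>\<close>.  There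
  every inward direction \<open>v\<close> satisfies \<open>v \<bullet> \<nu> \<ge> 0\<close>, which forces \<open>\<nu>\<close> to be strictly inward; hence near
  \<open>p\<close> short translations along \<open>\<nu>\<close>, such as the reflections, do not leave the domain.\<close>

lemma small_caps_reflect_inside:
  fixes \<Omega> :: "'a::euclidean_space set"
  assumes dom: "bounded_smooth_domain \<Omega>" and \<nu>: "norm \<nu> = 1"
  shows "\<exists>l > cap_start \<Omega> \<nu>. \<forall>t. cap_start \<Omega> \<nu> < t \<and> t \<le> l \<longrightarrow> refl_hyp \<nu> t ` cap \<Omega> \<nu> t \<subseteq> \<Omega>"
proof (rule ccontr)
  let ?a = "cap_start \<Omega> \<nu>"
  assume neg: "\<not> ?thesis"
  have op: "open \<Omega>" and bd: "bounded \<Omega>" using dom unfolding bounded_smooth_domain_def by auto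
  have \<nu>\<nu>: "\<nu> \<bullet> \<nu> = 1" using \<nu> by (simp add: norm_eq_1)
  have "\<exists>t x. ?a < t \<and> t \<le> ?a + inverse (real (Suc n)) \<and> x \<in> cap \<Omega> \<nu> t \<and> refl_hyp \<nu> t x \<notin> \<Omega>" for n
  proof -
    have "?a + inverse (real (Suc n)) > ?a" by simp
    then show ?thesis using neg by blast
  qed
  then obtain t x where t: "\<And>n. ?a < t n" "\<And>n. t n \<le> ?a + inverse (real (Suc n))"
    and x: "\<And>n. x n \<in> cap \<Omega> \<nu> (t n)" "\<And>n. refl_hyp \<nu> (t n) (x n) \<notin> \<Omega>"
    by metis
  have "compact (closure \<Omega>)" using bd by simp
  moreover have "x n \<in> closure \<Omega>" for n using x(1)[of n] closure_subset by (auto simp: cap_def)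
  ultimately obtain p s where p: "p \<in> closure \<Omega>" and s: "strict_mono s" "(x \<circ> s) \<longlonglongrightarrow> p"
    unfolding compact_def by metis
  have xs: "(\<lambda>n. x (s n)) \<longlonglongrightarrow> p" using s(2) by (simp add: o_def)
  have "(\<lambda>n. ?a + inverse (real (Suc n))) \<longlonglongrightarrow> ?a + 0"
    by (intro tendsto_intros LIMSEQ_inverse_real_of_nat)
  then have "t \<longlonglongrightarrow> ?a"
    using t by (intro real_tendsto_sandwich[of "\<lambda>_. ?a" t sequentially "\<lambda>n. ?a + inverse (real (Suc n))" ?a]
        always_eventually allI) (simp_all only: add_0_right less_imp_le tendsto_const)
  then have ts: "(\<lambda>n. t (s n)) \<longlonglongrightarrow> ?a" using LIMSEQ_subseq_LIMSEQ[OF _ s(1)] by (auto simp: o_def)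
  have pa: "p \<bullet> \<nu> = ?a"
  proof (rule antisym)
    show "?a \<le> p \<bullet> \<nu>" by (rule cap_start_le[OF bd p])
    show "p \<bullet> \<nu> \<le> ?a"
      by (rule LIMSEQ_le[OF tendsto_inner[OF xs tendsto_const] ts])
        (use x(1) in \<open>auto simp: cap_def intro: less_imp_le\<close>)
  qed
  then have "p \<notin> \<Omega>" using cap_start_less[OF bd op _ \<nu>] by force
  then have pf: "p \<in> frontier \<Omega>" using p op by (simp add: frontier_def interior_open)
  obtain r e \<phi> F where r: "r > 0" and e: "norm e = 1"
    and D\<phi>: "\<And>x. (\<phi> has_derivative (\<lambda>v. F x \<bullet> v)) (at x)" and Fc: "continuous_on UNIV F"
    and Fe: "\<And>x. F x \<bullet> e = 1"
    and chart: "\<And>x. x \<in> ball p r \<Longrightarrow> x \<in> \<Omega> \<longleftrightarrow> \<phi> x > 0"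
    and \<phi>0: "\<And>x. x \<in> ball p r \<Longrightarrow> x \<in> frontier \<Omega> \<Longrightarrow> \<phi> x = 0"
    using defining_function_at_frontier[OF dom pf] by metis
  have \<phi>p: "\<phi> p = 0" using \<phi>0 pf r by simp
  have inward: "v \<bullet> \<nu> \<ge> 0" if v: "F p \<bullet> v > 0" for v
  proof -
    have "((\<lambda>h. \<phi> (p + h *\<^sub>R v)) has_real_derivative F p \<bullet> v) (at 0)"
      by (rule has_real_derivative_along_line) (use D\<phi> in simp)
    from DERIV_pos_inc_right[OF this v] \<phi>p
    obtain d where d: "d > 0" "\<And>h. 0 < h \<Longrightarrow> h < d \<Longrightarrow> 0 < \<phi> (p + h *\<^sub>R v)" by auto
    define h where "h = min (d / 2) (r / (2 * (norm v + 1)))"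
    have nv: "norm v + 1 > 0" by (simp add: add_nonneg_pos)
    have h: "0 < h" "h < d" using d r nv by (auto simp: h_def)
    have "h \<le> r / (2 * (norm v + 1))" by (simp add: h_def)
    then have "h * (2 * (norm v + 1)) \<le> r" using nv by (simp add: pos_le_divide_eq)
    then have "2 * (h * norm v) + 2 * h \<le> r" by (simp add: algebra_simps)
    moreover have "h * norm v \<ge> 0" using h by simp
    ultimately have "h * norm v < r" using h by linarith
    then have "p + h *\<^sub>R v \<in> ball p r" using h by (simp add: dist_norm)
    then have "p + h *\<^sub>R v \<in> \<Omega>" using chart d(2)[OF h] by blast
    then have "?a \<le> (p + h *\<^sub>R v) \<bullet> \<nu>" using closure_subset by (intro cap_start_le[OF bd]) blast
    then show ?thesis using pa h by (simp add: inner_add_left zero_le_mult_iff)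
  qed
  have F\<nu>: "F p \<bullet> \<nu> > 0"
  proof (rule ccontr)
    assume "\<not> F p \<bullet> \<nu> > 0"
    \<comment> \<open>Then \<open>e - c *\<^sub>R \<nu>\<close> is inward for every \<open>c \<ge> 0\<close>, but for large \<open>c\<close> it points below the
      supporting hyperplane.\<close>
    define c where "c = 1 + \<bar>e \<bullet> \<nu>\<bar>"
    have "c * (F p \<bullet> \<nu>) \<le> 0"
      using \<open>\<not> F p \<bullet> \<nu> > 0\<close> by (simp add: c_def mult_nonneg_nonpos)
    then have "F p \<bullet> (e - c *\<^sub>R \<nu>) > 0" using Fe by (simp add: inner_diff_right)
    from inward[OF this] show False by (simp add: inner_diff_left \<nu>\<nu> c_def)
  qed
  have "open {x. F x \<bullet> \<nu> > 0}"
    by (intro open_Collect_less continuous_intros Fc)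
  then obtain d where d: "d > 0" "ball p d \<subseteq> {x. F x \<bullet> \<nu> > 0}"
    using F\<nu> open_contains_ball by (metis mem_Collect_eq)
  define d' where "d' = min d r"
  have d': "d' > 0" using d r by (simp add: d'_def)
  have "(\<lambda>n. refl_hyp \<nu> (t (s n)) (x (s n))) \<longlonglongrightarrow> p + (2 * (?a - p \<bullet> \<nu>)) *\<^sub>R \<nu>"
    unfolding refl_hyp_def by (intro tendsto_intros xs ts)
  then have "(\<lambda>n. refl_hyp \<nu> (t (s n)) (x (s n))) \<longlonglongrightarrow> p" by (simp add: pa)
  from eventually_conj[OF tendstoD[OF this d'] tendstoD[OF xs d']]
  obtain n where n: "dist (refl_hyp \<nu> (t (s n)) (x (s n))) p < d'" "dist (x (s n)) p < d'"
    using eventually_happens'[OF sequentially_bot] by blast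
  define \<xi> where "\<xi> = x (s n)"
  define b where "b = 2 * (t (s n) - \<xi> \<bullet> \<nu>)"
  have b: "b > 0" and \<xi>\<Omega>: "\<xi> \<in> \<Omega>" using x(1)[of "s n"] by (auto simp: b_def \<xi>_def cap_def)
  have refl: "refl_hyp \<nu> (t (s n)) (x (s n)) = \<xi> + b *\<^sub>R \<nu>" by (simp add: refl_hyp_def b_def \<xi>_def)
  have ends: "\<xi> + b *\<^sub>R \<nu> \<in> ball p d'" "\<xi> \<in> ball p d'"
    using n refl by (auto simp: \<xi>_def dist_commute)
  have seg: "\<xi> + h *\<^sub>R \<nu> \<in> ball p d'" if "0 \<le> h" "h \<le> b" for h
  proof -
    have "(1 - h / b) *\<^sub>R \<xi> + (h / b) *\<^sub>R (\<xi> + b *\<^sub>R \<nu>) \<in> ball p d'"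
      using convexD[OF convex_ball ends(2,1)] that b by auto
    then show ?thesis using b by (simp add: algebra_simps)
  qed
  have "\<exists>h. 0 < h \<and> h < b \<and> \<phi> (\<xi> + b *\<^sub>R \<nu>) - \<phi> (\<xi> + 0 *\<^sub>R \<nu>) = (b - 0) * (F (\<xi> + h *\<^sub>R \<nu>) \<bullet> \<nu>)"
    by (rule MVT2[OF b]) (rule has_real_derivative_along_line[OF D\<phi>])
  then obtain h where h: "0 < h" "h < b" "\<phi> (\<xi> + b *\<^sub>R \<nu>) = \<phi> \<xi> + b * (F (\<xi> + h *\<^sub>R \<nu>) \<bullet> \<nu>)"
    by (auto simp: algebra_simps)
  have "F (\<xi> + h *\<^sub>R \<nu>) \<bullet> \<nu> > 0" using seg[of h] h d by (auto simp: d'_def)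
  moreover have "\<phi> \<xi> > 0" using chart[of \<xi>] \<xi>\<Omega> ends by (simp add: d'_def)
  ultimately have "\<phi> (\<xi> + b *\<^sub>R \<nu>) > 0" using h b by (simp add: add_pos_pos)
  then have "\<xi> + b *\<^sub>R \<nu> \<in> \<Omega>" using chart ends by (simp add: d'_def)
  then show False using x(2)[of "s n"] refl by simp
qed

lemma reflected_cap_subset:
  fixes \<Omega> :: "'a::euclidean_space set"
  assumes "bounded_smooth_domain \<Omega>" "norm \<nu> = 1" and "cap_start \<Omega> \<nu> < l" "l < lambda1 \<Omega> \<nu>"
  obtains l' where "l < l'" "\<And>t. cap_start \<Omega> \<nu> < t \<Longrightarrow> t \<le> l' \<Longrightarrow> refl_hyp \<nu> t ` cap \<Omega> \<nu> t \<subseteq> \<Omega>"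
proof -
  let ?S = "{l. cap_start \<Omega> \<nu> < l \<and> (\<forall>t. cap_start \<Omega> \<nu> < t \<and> t \<le> l \<longrightarrow> refl_hyp \<nu> t ` cap \<Omega> \<nu> t \<subseteq> \<Omega>)}"
  have "?S \<noteq> {}" using small_caps_reflect_inside[OF assms(1,2)] by blast
  moreover have "l < Sup ?S" using assms(4) unfolding lambda1_def .
  ultimately obtain l' where "l' \<in> ?S" "l < l'" using less_cSupE by blast
  then show thesis using that by blast
qed

section \<open>Reflections and differences with the reflected function\<close>

text \<open>The linear part of the reflection \<open>refl_hyp \<nu> l\<close>.\<close>

definition mirror :: "'a::euclidean_space \<Rightarrow> 'a \<Rightarrow> 'a" where
  "mirror \<nu> v = v - (2 * (v \<bullet> \<nu>)) *\<^sub>R \<nu>"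

lemma mirror_inner_commute: "mirror \<nu> v \<bullet> w = v \<bullet> mirror \<nu> w"
  by (simp add: mirror_def inner_diff_left inner_diff_right inner_commute)

lemma mirror_mirror: "norm \<nu> = 1 \<Longrightarrow> mirror \<nu> (mirror \<nu> v) = v"
  by (simp add: mirror_def inner_diff_left norm_eq_1 algebra_simps)

lemma mirror_has_derivative: "(mirror \<nu> has_derivative mirror \<nu>) (at x)"
  unfolding mirror_def by (auto intro!: derivative_eq_intros)

lemma refl_hyp_has_derivative: "(refl_hyp \<nu> l has_derivative mirror \<nu>) (at x)"
  unfolding refl_hyp_def mirror_def by (auto intro!: derivative_eq_intros)

lemma refl_hyp_fixed: "x \<bullet> \<nu> = l \<Longrightarrow> refl_hyp \<nu> l x = x"
  by (simp add: refl_hyp_def)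

lemma continuous_on_refl_hyp: "continuous_on S (refl_hyp \<nu> l)"
  unfolding refl_hyp_def by (intro continuous_intros)

lemma has_hessian_on_reflection_difference:
  fixes v :: "'a::euclidean_space \<Rightarrow> real"
  assumes \<nu>: "norm \<nu> = 1" and hess: "has_hessian_on v G H S"
    and T: "T \<subseteq> S" "refl_hyp \<nu> l ` T \<subseteq> S"
  shows "has_hessian_on (\<lambda>x. v (refl_hyp \<nu> l x) - v x)
     (\<lambda>x. mirror \<nu> (G (refl_hyp \<nu> l x)) - G x)
     (\<lambda>x h. mirror \<nu> (H (refl_hyp \<nu> l x) (mirror \<nu> h)) - H x h) T"
proof (rule has_hessian_on_diff[OF _ has_hessian_on_subset[OF hess T(1)]])
  show "has_hessian_on (\<lambda>x. v (refl_hyp \<nu> l x)) (\<lambda>x. mirror \<nu> (G (refl_hyp \<nu> l x)))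
     (\<lambda>x h. mirror \<nu> (H (refl_hyp \<nu> l x) (mirror \<nu> h))) T"
    unfolding has_hessian_on_def
  proof (intro ballI conjI)
    fix x assume "x \<in> T"
    then have x: "refl_hyp \<nu> l x \<in> S" using T by blast
    show "((\<lambda>x. v (refl_hyp \<nu> l x)) has_derivative (\<lambda>h. mirror \<nu> (G (refl_hyp \<nu> l x)) \<bullet> h)) (at x)"
      using has_derivative_compose[OF refl_hyp_has_derivative has_hessian_onD(1)[OF hess x]]
      by (simp only: mirror_inner_commute)
    show "((\<lambda>x. mirror \<nu> (G (refl_hyp \<nu> l x))) has_derivative
       (\<lambda>h. mirror \<nu> (H (refl_hyp \<nu> l x) (mirror \<nu> h)))) (at x)"
      by (rule has_derivative_compose[OF has_derivative_compose[OF refl_hyp_has_derivative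
            has_hessian_onD(2)[OF hess x]] mirror_has_derivative])
  qed
qed

lemma endo_trace_reflection_difference:
  assumes "norm \<nu> = 1" and "has_hessian_on v G H S" "refl_hyp \<nu> l x \<in> S"
  shows "endo_trace (\<lambda>h. mirror \<nu> (H (refl_hyp \<nu> l x) (mirror \<nu> h)) - H x h)
    = endo_trace (H (refl_hyp \<nu> l x)) - endo_trace (H x)"
proof -
  have "linear (H (refl_hyp \<nu> l x))"
    by (rule has_derivative_linear[OF has_hessian_onD(2)[OF assms(2,3)]])
  then have "endo_trace (\<lambda>h. mirror \<nu> (H (refl_hyp \<nu> l x) (mirror \<nu> h))) = endo_trace (H (refl_hyp \<nu> l x))"
    by (intro endo_trace_conjugate_involution mirror_inner_commute mirror_mirror assms(1))
  then show ?thesis by (simp only: endo_trace_diff)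
qed

lemma open_cap: "open \<Omega> \<Longrightarrow> open (cap \<Omega> \<nu> l)"
proof -
  assume "open \<Omega>"
  then have "open (\<Omega> \<inter> {x. x \<bullet> \<nu> < l})"
    by (intro open_Int open_Collect_less continuous_intros)
  then show ?thesis by (simp add: cap_def Int_def)
qed

lemma closure_cap:
  assumes "x \<in> closure (cap \<Omega> \<nu> l)" shows "x \<in> closure \<Omega>" "x \<bullet> \<nu> \<le> l"
proof -
  show "x \<in> closure \<Omega>"
    using assms closure_mono[of "cap \<Omega> \<nu> l" \<Omega>] by (auto simp: cap_def)
  have "closed {x. x \<bullet> \<nu> \<le> l}" by (intro closed_Collect_le continuous_intros)
  moreover have "cap \<Omega> \<nu> l \<subseteq> {x. x \<bullet> \<nu> \<le> l}" by (auto simp: cap_def)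
  ultimately show "x \<bullet> \<nu> \<le> l" using assms closure_minimal by blast
qed

lemma refl_hyp_closure_cap:
  assumes "refl_hyp \<nu> l ` cap \<Omega> \<nu> l \<subseteq> \<Omega>" "x \<in> closure (cap \<Omega> \<nu> l)"
  shows "refl_hyp \<nu> l x \<in> closure \<Omega>"
proof -
  have "refl_hyp \<nu> l ` closure (cap \<Omega> \<nu> l) \<subseteq> closure \<Omega>"
    by (rule image_closure_subset[OF continuous_on_refl_hyp closed_closure])
      (use assms(1) closure_subset in blast)
  then show ?thesis using assms(2) by blast
qed

lemma frontier_cap:
  assumes "open \<Omega>" "x \<in> frontier (cap \<Omega> \<nu> l)"
  shows "x \<in> frontier \<Omega> \<or> x \<bullet> \<nu> = l"
proof -
  have x: "x \<in> closure (cap \<Omega> \<nu> l)" "x \<notin> cap \<Omega> \<nu> l"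
    using assms open_cap[OF assms(1)] by (auto simp: frontier_def interior_open)
  then show ?thesis
    using closure_cap[OF x(1)] assms(1) by (auto simp: cap_def frontier_def interior_open)
qed

section \<open>The nonlinearities\<close>

lemma powr_neg_increment_mono:
  fixes s s' t \<gamma> :: real
  assumes "\<gamma> > 0" "0 < s" "s \<le> s'" "0 \<le> t"
  shows "(s + t) powr (- \<gamma>) - s powr (- \<gamma>) \<le> (s' + t) powr (- \<gamma>) - s' powr (- \<gamma>)"
proof (rule DERIV_nonneg_imp_nondecreasing[OF assms(3)])
  fix r assume "s \<le> r" "r \<le> s'"
  then have r: "r > 0" using assms by simp
  have "((\<lambda>r. (r + t) powr (- \<gamma>)) has_real_derivative (- \<gamma> * (r + t) powr (- \<gamma> - 1)) * (1 + 0)) (at r)"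
  proof (rule DERIV_chain2[OF has_real_derivative_powr])
    show "0 < r + t" using r assms by simp
    show "((\<lambda>r. r + t) has_real_derivative 1 + 0) (at r)" by (intro DERIV_add DERIV_ident DERIV_const)
  qed
  from DERIV_diff[OF this has_real_derivative_powr[OF r, of "- \<gamma>"]]
  have "((\<lambda>r. (r + t) powr (- \<gamma>) - r powr (- \<gamma>)) has_real_derivative
     \<gamma> * (r powr (- \<gamma> - 1) - (r + t) powr (- \<gamma> - 1))) (at r)"
    by (simp add: algebra_simps)
  moreover have "0 \<le> \<gamma> * (r powr (- \<gamma> - 1) - (r + t) powr (- \<gamma> - 1))"
    using r assms powr_mono2'[of "- \<gamma> - 1" r "r + t"] by simp
  ultimately show "\<exists>y. ((\<lambda>r. (r + t) powr (- \<gamma>) - r powr (- \<gamma>)) has_real_derivative y) (at r) \<and> 0 \<le> y"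
    by blast
qed

lemma powr_neg_decrease_bound:
  fixes a b c \<gamma> :: real
  assumes "\<gamma> > 0" "0 < c" "c \<le> a" "a \<le> b"
  shows "a powr (- \<gamma>) - b powr (- \<gamma>) \<le> \<gamma> * c powr (- \<gamma> - 1) * (b - a)"
proof (cases "a = b")
  case False
  then have ab: "a < b" using assms by simp
  have "\<exists>z. a < z \<and> z < b \<and> b powr (- \<gamma>) - a powr (- \<gamma>) = (b - a) * (- \<gamma> * z powr (- \<gamma> - 1))"
    by (rule MVT2[OF ab]) (use assms in \<open>intro has_real_derivative_powr; simp\<close>)
  then obtain z where z: "a < z" "a powr (- \<gamma>) - b powr (- \<gamma>) = \<gamma> * z powr (- \<gamma> - 1) * (b - a)"
    by (auto simp: algebra_simps)
  have "z powr (- \<gamma> - 1) \<le> c powr (- \<gamma> - 1)"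
    using z assms by (intro powr_mono2') auto
  then have "\<gamma> * z powr (- \<gamma> - 1) * (b - a) \<le> \<gamma> * c powr (- \<gamma> - 1) * (b - a)"
    using assms by (intro mult_right_mono mult_left_mono) auto
  then show ?thesis using z by simp
qed simp

lemma locally_lipschitz_on_atLeast_bounded:
  assumes "locally_lipschitz_on {0..} f"
  obtains L where "L \<ge> 0" "\<And>s t. s \<in> {0..M} \<Longrightarrow> t \<in> {0..M} \<Longrightarrow> \<bar>f s - f t\<bar> \<le> L * \<bar>s - t\<bar>"
proof -
  have "local_lipschitz {0::real} {0..M} (\<lambda>_. f)"
  proof (rule local_lipschitzI)
    fix t s :: real assume "s \<in> {0..M}"
    then obtain e L where "e > 0" "L-lipschitz_on (cball s e \<inter> {0..}) f"
      using assms unfolding locally_lipschitz_on_def by (meson atLeastAtMost_iff atLeast_iff)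
    then have "L-lipschitz_on (cball s e \<inter> {0..M}) f"
      by (auto intro: lipschitz_on_subset)
    then show "\<exists>u>0. \<exists>L. \<forall>t\<in>cball t u \<inter> {0}. L-lipschitz_on (cball s u \<inter> {0..M}) f"
      using \<open>e > 0\<close> by blast
  qed
  then obtain L where L: "L-lipschitz_on {0..M} f"
    using local_lipschitz_compact_implies_lipschitz[of "{0::real}" "{0..M}" "\<lambda>_. f"]
    by (metis compact_Icc compact_sing continuous_on_const singletonI)
  show thesis
    using that[OF lipschitz_on_nonneg[OF L]] lipschitz_onD[OF L] by (simp add: dist_real_def)
qed

lemma right_derivative_nonneg:
  fixes D :: "real \<Rightarrow> real"
  assumes "(D has_real_derivative d) (at 0)" "D 0 = 0" "r > 0"
    and "\<And>h. 0 < h \<Longrightarrow> h < r \<Longrightarrow> D h \<ge> 0"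
  shows "d \<ge> 0"
proof (rule ccontr)
  assume "\<not> d \<ge> 0"
  then have "d < 0" by simp
  from DERIV_neg_dec_right[OF assms(1) this] obtain e where
    e: "e > 0" "\<And>h. 0 < h \<Longrightarrow> h < e \<Longrightarrow> D h < 0"
    using assms(2) by auto
  define h where "h = min e r / 2"
  have "0 < h" "h < e" "h < r" using e(1) assms(3) by (auto simp: h_def min_def)
  then show False using e(2)[of h] assms(4)[of h] by simp
qed

section \<open>Comparison and strict monotonicity under reflection\<close>

text \<open>Two classical solutions, \<open>u\<close> of the full problem and \<open>u0\<close> of the purely singular one, together
  with their gradients and Hessians.\<close>

locale singular_solutions =
  fixes \<Omega> :: "'a::euclidean_space set" and f :: "real \<Rightarrow> real" and \<gamma> :: real
    and u u0 :: "'a \<Rightarrow> real" and Gu G0 :: "'a \<Rightarrow> 'a" and Hu H0 :: "'a \<Rightarrow> 'a \<Rightarrow> 'a" and \<nu> :: 'a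
  assumes \<gamma>: "\<gamma> > 0" and domain: "bounded_smooth_domain \<Omega>"
    and f_lipschitz: "locally_lipschitz_on {0..} f"
    and f_mono: "mono_on {0..} f" and f_pos: "\<And>s. s > 0 \<Longrightarrow> f s > 0"
    and u_cont: "continuous_on (closure \<Omega>) u" and u0_cont: "continuous_on (closure \<Omega>) u0"
    and u_hess: "has_hessian_on u Gu Hu \<Omega>" and u0_hess: "has_hessian_on u0 G0 H0 \<Omega>"
    and u_eq: "\<And>x. x \<in> \<Omega> \<Longrightarrow> endo_trace (Hu x) = - (u x powr (- \<gamma>) + f (u x))"
    and u0_eq: "\<And>x. x \<in> \<Omega> \<Longrightarrow> endo_trace (H0 x) = - (u0 x powr (- \<gamma>))"
    and u_pos: "\<And>x. x \<in> \<Omega> \<Longrightarrow> u x > 0" and u0_pos: "\<And>x. x \<in> \<Omega> \<Longrightarrow> u0 x > 0"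
    and u_bdry: "\<And>x. x \<in> frontier \<Omega> \<Longrightarrow> u x = 0" and u0_bdry: "\<And>x. x \<in> frontier \<Omega> \<Longrightarrow> u0 x = 0"
    and unit: "norm \<nu> = 1"
begin

abbreviation "a \<equiv> cap_start \<Omega> \<nu>"
abbreviation "\<Omega>c l \<equiv> cap \<Omega> \<nu> l"
abbreviation "R l \<equiv> refl_hyp \<nu> l"

definition w :: "'a \<Rightarrow> real" where "w x = u x - u0 x"

text \<open>The function \<open>w\<^sub>\<lambda> - w\<close> of the moving plane method.\<close>

definition z :: "real \<Rightarrow> 'a \<Rightarrow> real" where "z l x = w (R l x) - w x"

text \<open>The Hessian of \<open>z l\<close>.\<close>

definition Hz :: "real \<Rightarrow> 'a \<Rightarrow> 'a \<Rightarrow> 'a" where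
  "Hz l x h = mirror \<nu> (Hu (R l x) (mirror \<nu> h) - H0 (R l x) (mirror \<nu> h)) - (Hu x h - H0 x h)"

lemma open_domain: "open \<Omega>" and bounded_domain: "bounded \<Omega>"
  using domain unfolding bounded_smooth_domain_def by auto

lemma compact_closure: "compact (closure \<Omega>)"
  using bounded_domain by simp

lemma closureE:
  assumes "x \<in> closure \<Omega>" obtains "x \<in> \<Omega>" | "x \<in> frontier \<Omega>"
  using assms open_domain by (auto simp: frontier_def interior_open)

lemma in_closure: "x \<in> \<Omega> \<Longrightarrow> x \<in> closure \<Omega>"
  using closure_subset by blast

lemma unit_inner: "\<nu> \<bullet> \<nu> = 1"
  using unit by (simp add: norm_eq_1)

lemma w_cont: "continuous_on (closure \<Omega>) w"
  unfolding w_def by (intro continuous_intros u_cont u0_cont)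

lemma w_hess: "has_hessian_on w (\<lambda>x. Gu x - G0 x) (\<lambda>x h. Hu x h - H0 x h) \<Omega>"
  unfolding w_def by (rule has_hessian_on_diff[OF u_hess u0_hess])

text \<open>At a nonpositive interior minimum of \<open>w\<close> one has \<open>u \<le> u0\<close>, hence \<open>- \<Delta>w \<ge> f u > 0\<close>.\<close>

lemma w_pos: assumes "x \<in> \<Omega>" shows "w x > 0"
proof (rule ccontr)
  assume neg: "\<not> w x > 0"
  have "closure \<Omega> \<noteq> {}" using assms by auto
  from continuous_attains_inf[OF compact_closure this w_cont]
  obtain p where p: "p \<in> closure \<Omega>" "\<And>y. y \<in> closure \<Omega> \<Longrightarrow> w p \<le> w y" by blast
  \<comment> \<open>If the minimum is attained on the boundary, then it is \<open>0\<close>, and \<open>x\<close> is another minimum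
    point.\<close>
  obtain q where q: "q \<in> \<Omega>" "\<And>y. y \<in> closure \<Omega> \<Longrightarrow> w q \<le> w y"
    using p(1)
  proof (cases rule: closureE)
    case 1
    then show thesis using that p(2) by blast
  next
    case 2
    then have "w x \<le> w p" using neg u_bdry u0_bdry by (simp add: w_def)
    then have "w x \<le> w y" if "y \<in> closure \<Omega>" for y using p(2)[OF that] by simp
    then show thesis using that[OF assms] by blast
  qed
  have "endo_trace (\<lambda>h. Hu q h - H0 q h) \<ge> 0"
    by (rule trace_hessian_nonneg_at_local_min[OF w_hess open_domain q(1)]) (use q(2) in_closure in blast)
  then have "u0 q powr (- \<gamma>) - (u q powr (- \<gamma>) + f (u q)) \<ge> 0"
    using q(1) by (simp add: endo_trace_diff u_eq u0_eq)
  moreover have "u q \<le> u0 q" using q(2)[OF in_closure[OF assms]] neg by (simp add: w_def)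
  then have "u0 q powr (- \<gamma>) \<le> u q powr (- \<gamma>)" using \<gamma> u_pos[OF q(1)] by (intro powr_mono2') auto
  ultimately show False using f_pos[OF u_pos[OF q(1)]] by simp
qed

lemma w_frontier: "x \<in> frontier \<Omega> \<Longrightarrow> w x = 0"
  using u_bdry u0_bdry by (simp add: w_def)

lemma w_nonneg: "x \<in> closure \<Omega> \<Longrightarrow> w x \<ge> 0"
  by (erule closureE) (auto simp: w_frontier intro: less_imp_le w_pos)

lemma capD: "x \<in> \<Omega>c l \<Longrightarrow> x \<in> \<Omega>"
  by (simp add: cap_def)

lemma reflection_cont:
  fixes v :: "'a \<Rightarrow> real"
  assumes "R l ` \<Omega>c l \<subseteq> \<Omega>" "continuous_on (closure \<Omega>) v"
  shows "continuous_on (closure (\<Omega>c l)) (\<lambda>x. v (R l x) - v x)"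
proof (rule continuous_on_diff)
  show "continuous_on (closure (\<Omega>c l)) (\<lambda>x. v (R l x))"
    by (rule continuous_on_compose2[OF assms(2) continuous_on_refl_hyp])
      (use refl_hyp_closure_cap[OF assms(1)] in blast)
  show "continuous_on (closure (\<Omega>c l)) v"
    by (rule continuous_on_subset[OF assms(2)]) (use closure_cap(1) in blast)
qed

lemma compact_closure_cap: "compact (closure (\<Omega>c l))"
proof -
  have "bounded (\<Omega>c l)" by (rule bounded_subset[OF bounded_domain]) (auto simp: cap_def)
  then show ?thesis by simp
qed

lemma closure_cap_cases:
  assumes "x \<in> closure (\<Omega>c l)"
  obtains "x \<in> \<Omega>c l" | "x \<in> frontier (\<Omega>c l)"
  using assms open_cap[OF open_domain] by (auto simp: frontier_def interior_open)

text \<open>As \<open>s powr (- \<gamma>)\<close> is decreasing, \<open>u0\<close> is monotone under every admissible reflection by a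
  single application of the maximum principle.\<close>

lemma u0_le_reflection:
  assumes sub: "R l ` \<Omega>c l \<subseteq> \<Omega>" and x: "x \<in> \<Omega>c l"
  shows "u0 x \<le> u0 (R l x)"
proof (rule ccontr)
  assume neg: "\<not> u0 x \<le> u0 (R l x)"
  let ?v = "\<lambda>x. u0 (R l x) - u0 x"
  have "x \<in> closure (\<Omega>c l)" using x closure_subset by blast
  have "closure (\<Omega>c l) \<noteq> {}" using x by auto
  from continuous_attains_inf[OF compact_closure_cap this reflection_cont[OF sub u0_cont]]
  obtain p where p: "p \<in> closure (\<Omega>c l)" "\<And>y. y \<in> closure (\<Omega>c l) \<Longrightarrow> ?v p \<le> ?v y" by blast
  have vp: "?v p < 0" using p(2)[OF \<open>x \<in> closure (\<Omega>c l)\<close>] neg by simp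
  have "p \<in> \<Omega>c l"
    using p(1)
  proof (cases rule: closure_cap_cases)
    case 2
    have "?v p \<ge> 0"
      using frontier_cap[OF open_domain 2]
    proof
      assume "p \<in> frontier \<Omega>"
      moreover have "R l p \<in> closure \<Omega>" by (rule refl_hyp_closure_cap[OF sub p(1)])
      then have "u0 (R l p) \<ge> 0"
        by (cases rule: closureE) (auto simp: u0_bdry intro: less_imp_le u0_pos)
      ultimately show ?thesis by (simp add: u0_bdry)
    qed (simp add: refl_hyp_fixed)
    with vp show ?thesis by simp
  qed
  then have p\<Omega>: "p \<in> \<Omega>" "R l p \<in> \<Omega>" using sub capD by auto
  have "endo_trace (\<lambda>h. mirror \<nu> (H0 (R l p) (mirror \<nu> h)) - H0 p h) \<ge> 0"
  proof (rule trace_hessian_nonneg_at_local_min[OF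
        has_hessian_on_reflection_difference[OF unit u0_hess _ sub] open_cap[OF open_domain] \<open>p \<in> \<Omega>c l\<close>])
    show "\<Omega>c l \<subseteq> \<Omega>" using capD by blast
    show "?v p \<le> ?v y" if "y \<in> \<Omega>c l" for y using p(2) that closure_subset by blast
  qed
  then have "u0 p powr (- \<gamma>) - u0 (R l p) powr (- \<gamma>) \<ge> 0"
    using p\<Omega> by (simp add: endo_trace_reflection_difference[OF unit u0_hess] u0_eq)
  moreover have "u0 p powr (- \<gamma>) < u0 (R l p) powr (- \<gamma>)"
    using vp \<gamma> u0_pos p\<Omega> by (intro powr_less_mono2_neg) auto
  ultimately show False by simp
qed

lemma z_hess:
  assumes "T \<subseteq> \<Omega>" "R l ` T \<subseteq> \<Omega>"
  shows "has_hessian_on (z l) (\<lambda>x. mirror \<nu> (Gu (R l x) - G0 (R l x)) - (Gu x - G0 x)) (Hz l) T"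
  unfolding z_def Hz_def
  by (rule has_hessian_on_reflection_difference[OF unit w_hess assms])

lemma Hz_trace:
  assumes "x \<in> \<Omega>" "R l x \<in> \<Omega>"
  shows "endo_trace (Hz l x) =
    ((u x powr (- \<gamma>) - u0 x powr (- \<gamma>)) - (u (R l x) powr (- \<gamma>) - u0 (R l x) powr (- \<gamma>)))
    + (f (u x) - f (u (R l x)))"
proof -
  have "endo_trace (Hz l x) = endo_trace (\<lambda>h. Hu (R l x) h - H0 (R l x) h) - endo_trace (\<lambda>h. Hu x h - H0 x h)"
    unfolding Hz_def by (rule endo_trace_reflection_difference[OF unit w_hess assms(2)])
  then show ?thesis using assms by (simp add: endo_trace_diff u_eq u0_eq)
qed

lemma z_cont: "R l ` \<Omega>c l \<subseteq> \<Omega> \<Longrightarrow> continuous_on (closure (\<Omega>c l)) (z l)"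
  unfolding z_def by (rule reflection_cont[OF _ w_cont])

lemma z_frontier_nonneg:
  assumes sub: "R l ` \<Omega>c l \<subseteq> \<Omega>" and x: "x \<in> frontier (\<Omega>c l)"
  shows "z l x \<ge> 0"
  using frontier_cap[OF open_domain x]
proof
  assume "x \<in> frontier \<Omega>"
  moreover have "R l x \<in> closure \<Omega>"
    by (rule refl_hyp_closure_cap[OF sub]) (use x in \<open>simp add: frontier_def\<close>)
  ultimately show ?thesis by (simp add: z_def w_frontier w_nonneg)
qed (simp add: z_def refl_hyp_fixed)

text \<open>The differential inequality where \<open>w\<^sub>\<lambda> < w\<close>.  The singular terms have the good sign there
  because \<open>(s + t) powr (- \<gamma>) - s powr (- \<gamma>)\<close> increases in \<open>s\<close> and decreases in \<open>t\<close>, so that only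
  the Lipschitz constant of \<open>f\<close> on the range of \<open>u\<close> enters.\<close>

lemma z_ineq_where_negative:
  obtains L where "L \<ge> 0"
    "\<And>l x. R l ` \<Omega>c l \<subseteq> \<Omega> \<Longrightarrow> x \<in> \<Omega>c l \<Longrightarrow> z l x < 0 \<Longrightarrow> endo_trace (Hz l x) \<le> - L * z l x"
proof -
  have "bounded (u ` closure \<Omega>)"
    by (intro compact_imp_bounded compact_continuous_image u_cont compact_closure)
  then obtain M where M: "\<And>x. x \<in> closure \<Omega> \<Longrightarrow> u x \<le> M"
    by (meson abs_le_D1 bounded_real image_eqI)
  obtain L where L: "L \<ge> 0" "\<And>s t. s \<in> {0..M} \<Longrightarrow> t \<in> {0..M} \<Longrightarrow> \<bar>f s - f t\<bar> \<le> L * \<bar>s - t\<bar>"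
    using locally_lipschitz_on_atLeast_bounded[OF f_lipschitz] by metis
  have "endo_trace (Hz l x) \<le> - L * z l x" if sub: "R l ` \<Omega>c l \<subseteq> \<Omega>" and x: "x \<in> \<Omega>c l" and neg: "z l x < 0" for l x
  proof -
    have x\<Omega>: "x \<in> \<Omega>" "R l x \<in> \<Omega>" using sub x capD by auto
    define s s' t t' where "s = u0 x" and "s' = u0 (R l x)" and "t = w x" and "t' = w (R l x)"
    have u: "u x = s + t" "u (R l x) = s' + t'" by (simp_all add: s_def s'_def t_def t'_def w_def)
    have s: "0 < s" "s \<le> s'" using u0_pos x\<Omega> u0_le_reflection[OF sub x] by (simp_all add: s_def s'_def)
    have t: "0 < t'" "t' < t" using w_pos x\<Omega> neg by (simp_all add: t_def t'_def z_def)
    have "(s + t) powr (- \<gamma>) - s powr (- \<gamma>) \<le> (s + t') powr (- \<gamma>) - s powr (- \<gamma>)"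
      using \<gamma> s t powr_mono2'[of "- \<gamma>" "s + t'" "s + t"] by simp
    also have "\<dots> \<le> (s' + t') powr (- \<gamma>) - s' powr (- \<gamma>)"
      by (rule powr_neg_increment_mono) (use \<gamma> s t in auto)
    finally have sing: "(s + t) powr (- \<gamma>) - s powr (- \<gamma>) \<le> (s' + t') powr (- \<gamma>) - s' powr (- \<gamma>)" .
    have reg: "f (s + t) - f (s' + t') \<le> L * (t - t')"
    proof (cases "s + t \<le> s' + t'")
      case True
      then have "f (s + t) \<le> f (s' + t')" using f_mono s t by (auto elim!: mono_onD)
      moreover have "L * (t - t') \<ge> 0" using L(1) t by simp
      ultimately show ?thesis by simp
    next
      case False
      have "f (s + t) - f (s' + t') \<le> L * \<bar>(s + t) - (s' + t')\<bar>"
        using L(2)[of "s + t" "s' + t'"] M[OF in_closure[OF x\<Omega>(1)]] M[OF in_closure[OF x\<Omega>(2)]] u s t by simp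
      also have "\<dots> \<le> L * (t - t')"
        using False s L(1) by (intro mult_left_mono) auto
      finally show ?thesis .
    qed
    have "endo_trace (Hz l x) \<le> L * (t - t')"
      using Hz_trace[OF x\<Omega>] sing reg by (simp add: u s_def[symmetric] s'_def[symmetric])
    also have "\<dots> = - L * z l x" by (simp add: z_def t_def t'_def algebra_simps)
    finally show ?thesis .
  qed
  with L(1) show thesis using that by blast
qed

lemma z_ineq_where_nonneg:
  assumes sub: "R l ` \<Omega>c l \<subseteq> \<Omega>" and x: "x \<in> \<Omega>c l" and nonneg: "z l x \<ge> 0"
    and c: "0 < c" "c \<le> u x"
  shows "endo_trace (Hz l x) \<le> \<gamma> * c powr (- \<gamma> - 1) * z l x"
proof -
  have x\<Omega>: "x \<in> \<Omega>" "R l x \<in> \<Omega>" using sub x capD by auto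
  define s s' t t' where "s = u0 x" and "s' = u0 (R l x)" and "t = w x" and "t' = w (R l x)"
  have u: "u x = s + t" "u (R l x) = s' + t'" by (simp_all add: s_def s'_def t_def t'_def w_def)
  have s: "0 < s" "s \<le> s'" using u0_pos x\<Omega> u0_le_reflection[OF sub x] by (simp_all add: s_def s'_def)
  have t: "0 < t" "t \<le> t'" using w_pos x\<Omega> nonneg by (simp_all add: t_def t'_def z_def)
  have "(s + t) powr (- \<gamma>) - (s + t') powr (- \<gamma>) \<le> \<gamma> * c powr (- \<gamma> - 1) * ((s + t') - (s + t))"
    by (rule powr_neg_decrease_bound) (use \<gamma> c u t in auto)
  moreover have "(s + t') powr (- \<gamma>) - s powr (- \<gamma>) \<le> (s' + t') powr (- \<gamma>) - s' powr (- \<gamma>)"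
    by (rule powr_neg_increment_mono) (use \<gamma> s t in auto)
  moreover have "f (s + t) \<le> f (s' + t')" using f_mono s t by (auto elim!: mono_onD)
  ultimately show ?thesis
    using Hz_trace[OF x\<Omega>] by (simp add: u s_def[symmetric] s'_def[symmetric] z_def t_def[symmetric] t'_def[symmetric])
qed

text \<open>Quantitative positivity on a ball whose interior lies in the cap: the barrier behind both the
  strong maximum principle and the Hopf lemma.\<close>

lemma z_ball_lower_bound:
  assumes sub: "R l ` \<Omega>c l \<subseteq> \<Omega>" and nonneg: "\<And>x. x \<in> \<Omega>c l \<Longrightarrow> z l x \<ge> 0"
    and ball: "cball y r \<subseteq> \<Omega>" "ball y r \<subseteq> \<Omega>c l" "r > 0" and y: "z l y > 0"
  obtains \<eta> \<alpha> where "\<eta> > 0" "\<alpha> > 0"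
    "\<And>x. x \<in> cball y r \<Longrightarrow> \<eta> * (exp (- \<alpha> * (norm (x - y))\<^sup>2) - exp (- \<alpha> * r\<^sup>2)) \<le> z l x"
proof -
  have ball_cl: "cball y r \<subseteq> closure (\<Omega>c l)"
    using closure_mono[OF ball(2)] ball(3) by simp
  have cont: "continuous_on (cball y r) (z l)"
    by (rule continuous_on_subset[OF z_cont[OF sub] ball_cl])
  have z0: "z l x \<ge> 0" if "x \<in> cball y r" for x
  proof -
    have "x \<in> closure (\<Omega>c l)" using that ball_cl by blast
    then show ?thesis
      by (cases rule: closure_cap_cases) (use nonneg z_frontier_nonneg[OF sub] in auto)
  qed
  have "continuous_on (ball y r) (z l)" by (rule continuous_on_subset[OF cont]) auto
  then have "open (ball y r \<inter> z l -` {0<..})" 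
    by (intro continuous_open_preimage) auto
  then obtain e where e: "e > 0" "ball y e \<subseteq> ball y r \<inter> z l -` {0<..}"
  proof -
    have "y \<in> ball y r \<inter> z l -` {0<..}" using y ball(3) by simp
    with \<open>open (ball y r \<inter> z l -` {0<..})\<close> show thesis using that openE by blast
  qed
  define \<rho> where "\<rho> = min e r / 2"
  have \<rho>: "0 < \<rho>" "\<rho> < r" "\<rho> < e" using e(1) ball(3) by (auto simp: \<rho>_def min_def)
  have "continuous_on (cball y r) u" by (rule continuous_on_subset[OF u_cont]) (use ball(1) in_closure in blast)
  then obtain xm where xm: "xm \<in> cball y r" "\<And>x. x \<in> cball y r \<Longrightarrow> u xm \<le> u x"
    using continuous_attains_inf[of "cball y r" u] ball(3) by (auto simp del: mem_cball)
  have xmp: "u xm > 0" using u_pos xm(1) ball(1) by blast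
  show thesis
  proof (rule gauss_lower_bound_on_ball[OF \<rho>(1,2) cont])
    show "has_hessian_on (z l) (\<lambda>x. mirror \<nu> (Gu (R l x) - G0 (R l x)) - (Gu x - G0 x)) (Hz l) (ball y r)"
      by (rule z_hess) (use ball(2) sub capD in blast)+
    show "z l x > 0" if "x \<in> cball y \<rho>" for x
      using that \<rho>(3) e(2) by (auto simp: subset_eq)
    show "\<gamma> * u xm powr (- \<gamma> - 1) \<ge> 0" using \<gamma> by simp
    show "endo_trace (Hz l x) \<le> \<gamma> * u xm powr (- \<gamma> - 1) * z l x" if "x \<in> ball y r" for x
      by (rule z_ineq_where_nonneg[OF sub _ _ xmp]) (use that ball(2) nonneg xm(2)[of x] in auto)
  qed (use z0 that in auto)
qed

lemma z_pos_propagates: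
  assumes sub: "R l ` \<Omega>c l \<subseteq> \<Omega>" and nonneg: "\<And>x. x \<in> \<Omega>c l \<Longrightarrow> z l x \<ge> 0"
    and ball: "cball y r \<subseteq> \<Omega>c l" and y: "z l y > 0" and x: "x \<in> ball y r"
  shows "z l x > 0"
proof -
  have r: "r > 0" using x by (metis ball_empty empty_iff linorder_not_less)
  have b: "cball y r \<subseteq> \<Omega>" "ball y r \<subseteq> \<Omega>c l" using ball capD ball_subset_cball by blast+
  obtain \<eta> \<alpha> where \<eta>: "\<eta> > 0" "\<alpha> > 0"
    and low: "\<And>x. x \<in> cball y r \<Longrightarrow> \<eta> * (exp (- \<alpha> * (norm (x - y))\<^sup>2) - exp (- \<alpha> * r\<^sup>2)) \<le> z l x"
    using z_ball_lower_bound[OF sub nonneg b r y] by metis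
  have "norm (x - y) < r" using x by (simp add: dist_norm norm_minus_commute)
  then have "(norm (x - y))\<^sup>2 < r\<^sup>2" by (intro power_strict_mono) auto
  then have "\<eta> * (exp (- \<alpha> * (norm (x - y))\<^sup>2) - exp (- \<alpha> * r\<^sup>2)) > 0" using \<eta> by simp
  then show ?thesis using low[of x] x by simp
qed

lemma z_zero_set_open:
  assumes sub: "R l ` \<Omega>c l \<subseteq> \<Omega>" and nonneg: "\<And>x. x \<in> \<Omega>c l \<Longrightarrow> z l x \<ge> 0"
  shows "open {x \<in> \<Omega>c l. z l x = 0}"
proof (rule openI)
  fix x assume x: "x \<in> {x \<in> \<Omega>c l. z l x = 0}"
  then obtain r where r: "r > 0" "ball x r \<subseteq> \<Omega>c l"
    using open_cap[OF open_domain] open_contains_ball by (metis (no_types, lifting) mem_Collect_eq)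
  have "y \<in> {x \<in> \<Omega>c l. z l x = 0}" if y: "y \<in> ball x (r / 2)" for y
  proof -
    have d: "dist x y < r / 2" using y by simp
    then have y\<Omega>: "y \<in> \<Omega>c l" using r by auto
    have "cball y ((r - dist x y) / 2 + dist x y / 2) \<subseteq> ball x r"
    proof
      fix v assume "v \<in> cball y ((r - dist x y) / 2 + dist x y / 2)"
      then have "dist y v \<le> r / 2" by (simp add: field_simps)
      then show "v \<in> ball x r" using d dist_triangle[of x v y] by simp
    qed
    then have "cball y (r / 2) \<subseteq> \<Omega>c l" using r(2) by (simp add: field_simps)
    moreover have "x \<in> ball y (r / 2)" using d by (simp add: dist_commute)
    ultimately have "\<not> z l y > 0" using z_pos_propagates[OF sub nonneg] x by fastforce
    then show ?thesis using nonneg[OF y\<Omega>] y\<Omega> by simp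
  qed
  then show "\<exists>e>0. ball x e \<subseteq> {x \<in> \<Omega>c l. z l x = 0}"
    using r(1) by (intro exI[of _ "r / 2"]) auto
qed

text \<open>If \<open>w\<^sub>\<lambda> - w\<close> vanished at a point of the cap, then it would vanish along the ray from there in
  direction \<open>- \<nu>\<close> up to the boundary point \<open>p\<close> where the ray leaves the domain, so that the reflection
  of \<open>p\<close> would be a boundary point.  It is, however, also the reflection, through a slightly higher
  hyperplane, of a point of the ray, hence interior.\<close>

lemma z_pos:
  assumes l: "a < l" "l < l'" and sub: "\<And>t. a < t \<Longrightarrow> t \<le> l' \<Longrightarrow> R t ` \<Omega>c t \<subseteq> \<Omega>"
    and nonneg: "\<And>x. x \<in> \<Omega>c l \<Longrightarrow> z l x \<ge> 0" and x: "x \<in> \<Omega>c l"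
  shows "z l x > 0"
proof (rule ccontr)
  assume neg: "\<not> z l x > 0"
  have subl: "R l ` \<Omega>c l \<subseteq> \<Omega>" using sub l by simp
  define ray where "ray s = x - s *\<^sub>R \<nu>" for s
  have ray_inner: "ray s \<bullet> \<nu> = x \<bullet> \<nu> - s" for s by (simp add: ray_def inner_diff_left unit_inner)
  define S where "S = {s. s \<ge> 0 \<and> ray s \<notin> \<Omega>}"
  define b where "b = Inf S"
  have bdS: "bdd_below S" unfolding S_def by (intro bdd_belowI[of _ 0]) auto
  have "closed ({0..} \<inter> (ray -` (- \<Omega>)))"
    unfolding ray_def by (intro closed_Int closed_vimage continuous_intros) (use open_domain in auto)
  then have clS: "closed S" unfolding S_def by (simp add: Int_def vimage_def)
  have "x \<bullet> \<nu> > a" by (rule cap_start_less[OF bounded_domain open_domain capD[OF x] unit])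
  have "x \<bullet> \<nu> - a + 1 \<in> S"
  proof -
    have "ray (x \<bullet> \<nu> - a + 1) \<notin> \<Omega>"
      using cap_start_le[OF bounded_domain in_closure, of "ray (x \<bullet> \<nu> - a + 1)" \<nu>] ray_inner[of "x \<bullet> \<nu> - a + 1"] by auto
    then show ?thesis using \<open>x \<bullet> \<nu> > a\<close> by (simp add: S_def)
  qed
  then have "b \<in> S" unfolding b_def using closed_contains_Inf[OF _ bdS clS] by blast
  then have b0: "b \<ge> 0" "ray b \<notin> \<Omega>" by (auto simp: S_def)
  have "b \<noteq> 0" using b0(2) capD[OF x] by (auto simp: ray_def)
  then have b: "b > 0" using b0(1) by simp
  have ray\<Omega>: "ray s \<in> \<Omega>" if "0 \<le> s" "s < b" for s
    using cInf_lower[OF _ bdS, of s] that by (force simp: S_def b_def)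
  have raycap: "ray s \<in> \<Omega>c l" if "0 \<le> s" "s < b" for s
    using ray\<Omega>[OF that] x that ray_inner[of s] by (simp add: cap_def)
  have rayz: "z l (ray s) = 0" if s: "0 \<le> s" "s < b" for s
  proof (rule ccontr)
    assume nz: "z l (ray s) \<noteq> 0"
    let ?A = "{x \<in> \<Omega>c l. z l x = 0}" and ?B = "\<Omega>c l \<inter> z l -` {0<..}"
    have opB: "open ?B"
      by (rule continuous_open_preimage[OF continuous_on_subset[OF z_cont[OF subl] closure_subset]
            open_cap[OF open_domain]]) simp
    have "connected (ray ` {0..s})"
      unfolding ray_def by (intro connected_continuous_image continuous_intros) auto
    moreover have "ray ` {0..s} \<subseteq> ?A \<union> ?B"
      using raycap s nonneg by (force simp: less_le)
    moreover have "?A \<inter> ?B \<inter> ray ` {0..s} = {}" by auto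
    ultimately have "?A \<inter> ray ` {0..s} = {} \<or> ?B \<inter> ray ` {0..s} = {}"
      using connectedD[OF _ z_zero_set_open[OF subl nonneg] opB] by blast
    moreover have "x \<in> ?A \<inter> ray ` {0..s}"
      using neg nonneg[OF x] x s by (auto simp: ray_def intro!: image_eqI[of _ _ 0])
    moreover have "ray s \<in> ?B \<inter> ray ` {0..s}"
      using nz nonneg[OF raycap[OF s]] raycap[OF s] s by auto
    ultimately show False by blast
  qed
  define p where "p = ray b"
  have lim: "((\<lambda>s. ray s) \<longlongrightarrow> p) (at_left b)"
    unfolding p_def ray_def by (intro tendsto_intros)
  have ev: "\<forall>\<^sub>F s in at_left b. s \<in> {0<..<b}"
    by (rule eventually_at_left_real[OF b])
  have pcl: "p \<in> closure (\<Omega>c l)"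
  proof (rule Lim_in_closed_set[OF closed_closure _ _ lim])
    show "\<forall>\<^sub>F s in at_left b. ray s \<in> closure (\<Omega>c l)"
      using ev by eventually_elim (use raycap closure_subset in force)
  qed simp
  have pf: "p \<in> frontier \<Omega>"
    using closure_cap(1)[OF pcl] b0(2) open_domain by (simp add: frontier_def interior_open p_def)
  have "z l p = 0"
  proof -
    have "((\<lambda>s. z l (ray s)) \<longlongrightarrow> z l p) (at_left b)"
      by (rule continuous_on_tendsto_compose[OF z_cont[OF subl] lim pcl])
        (use ev in eventually_elim, use raycap closure_subset in force)
    moreover have "\<forall>\<^sub>F s in at_left b. z l (ray s) = 0"
      using ev by eventually_elim (use rayz in auto)
    then have "((\<lambda>s. z l (ray s)) \<longlongrightarrow> 0) (at_left b)"
      by (rule tendsto_eventually)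
    ultimately show ?thesis using tendsto_unique trivial_limit_at_left_real by blast
  qed
  then have wRp: "w (R l p) = 0" by (simp add: z_def w_frontier[OF pf])
  define d where "d = min (l' - l) (b / 4)"
  have d: "d > 0" "l + d \<le> l'" "2 * d < b" using l b by (auto simp: d_def min_def)
  define y where "y = ray (b - 2 * d)"
  have "y \<in> \<Omega>c (l + d)" using raycap[of "b - 2 * d"] d by (simp add: y_def cap_def)
  then have "R (l + d) y \<in> \<Omega>" using sub[of "l + d"] d l by auto
  moreover have "R (l + d) y = R l p"
  proof -
    have shift: "ray s + c *\<^sub>R \<nu> = x + (c - s) *\<^sub>R \<nu>" for s c
      by (simp add: ray_def scaleR_left_diff_distrib)
    have "2 * (l + d - (x \<bullet> \<nu> - (b - 2 * d))) - (b - 2 * d) = 2 * (l - (x \<bullet> \<nu> - b)) - b" by simp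
    then show ?thesis by (simp only: refl_hyp_def y_def p_def ray_inner shift)
  qed
  ultimately show False using w_pos[of "R l p"] wRp by simp
qed

section \<open>Moving planes and the Hopf lemma\<close>

text \<open>A negative minimum of \<open>z l\<close> keeps a distance from the boundary and from the hyperplane that does
  not depend on \<open>l\<close>.\<close>

lemma negative_min_far_from_boundary:
  obtains \<delta> where "\<delta> > 0"
    "\<And>l x. R l ` \<Omega>c l \<subseteq> \<Omega> \<Longrightarrow> x \<in> \<Omega>c l \<Longrightarrow> z l x < 0 \<Longrightarrow>
       (\<And>y. y \<in> closure (\<Omega>c l) \<Longrightarrow> z l x \<le> z l y) \<Longrightarrow>
       x \<bullet> \<nu> \<le> l - \<delta> \<and> (\<forall>p\<in>frontier \<Omega>. \<delta> \<le> dist x p)"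
proof -
  obtain \<kappa> \<rho> where \<kappa>: "\<kappa> > 0" "\<kappa> \<le> 1 / 4" and \<rho>: "\<rho> > 0"
    and ext: "\<And>p r. p \<in> frontier \<Omega> \<Longrightarrow> 0 < r \<Longrightarrow> r < \<rho> \<Longrightarrow>
       \<exists>y. dist y p \<le> r / 2 \<and> ball y (\<kappa> * r) \<inter> \<Omega> = {}"
    using uniform_exterior_balls[OF domain] by metis
  obtain L where L: "L \<ge> 0"
    and ineq: "\<And>l x. R l ` \<Omega>c l \<subseteq> \<Omega> \<Longrightarrow> x \<in> \<Omega>c l \<Longrightarrow> z l x < 0 \<Longrightarrow> endo_trace (Hz l x) \<le> - L * z l x"
    using z_ineq_where_negative by metis
  define A where "A = DIM('a) / \<kappa>\<^sup>2"
  define B where "B = 2 * A * DIM('a) * exp (- A)"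
  have B: "B > 0" using \<kappa> by (simp add: B_def A_def)
  \<comment> \<open>With \<open>r \<le> 1\<close>, the bound \<open>r \<le> B / (2 * (L + 1))\<close> gives \<open>L * r\<^sup>2 < B\<close>.\<close>
  define r where "r = min (\<rho> / 2) (min 1 (B / (2 * (L + 1))))"
  have r: "0 < r" "r < \<rho>" "r \<le> 1" "r \<le> B / (2 * (L + 1))"
    using \<rho> B L by (auto simp: r_def)
  have small: "L * r\<^sup>2 < B"
  proof -
    have "L * r\<^sup>2 \<le> L * r"
      using r L by (intro mult_left_mono) (auto simp: power2_eq_square mult_le_cancel_left1)
    also have "\<dots> \<le> (L + 1) * r" using r by simp
    also have "\<dots> \<le> B / 2" using r(4) L by (simp add: field_simps)
    finally show ?thesis using B by simp
  qed
  have no_ball: False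
    if sub: "R l ` \<Omega>c l \<subseteq> \<Omega>" and x: "x \<in> \<Omega>c l" "z l x < 0"
      and min: "\<And>y. y \<in> closure (\<Omega>c l) \<Longrightarrow> z l x \<le> z l y"
      and y: "ball y (\<kappa> * r) \<inter> \<Omega>c l = {}" "dist y x < r" for l x y
  proof (rule no_negative_min_near_exterior_ball[where D = "\<Omega>c l" and \<kappa> = \<kappa> and R = r and y = y and ?x0.0 = x])
    show "bounded (\<Omega>c l)" by (rule bounded_subset[OF bounded_domain]) (auto simp: cap_def)
    show "open (\<Omega>c l)" by (rule open_cap[OF open_domain])
    show "continuous_on (closure (\<Omega>c l)) (z l)" by (rule z_cont[OF sub])
    show "has_hessian_on (z l) (\<lambda>x. mirror \<nu> (Gu (R l x) - G0 (R l x)) - (Gu x - G0 x)) (Hz l) (\<Omega>c l)"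
      by (rule z_hess) (use sub capD in auto)
    show "L * r\<^sup>2 < 2 * (DIM('a) / \<kappa>\<^sup>2) * DIM('a) * exp (- (DIM('a) / \<kappa>\<^sup>2))"
      using small unfolding B_def A_def .
    show "endo_trace (Hz l v) \<le> - L * z l v" if "v \<in> \<Omega>c l" "z l v < 0" for v
      by (rule ineq[OF sub that])
  qed (use z_frontier_nonneg[OF sub] x min y \<kappa> r L in auto)
  show thesis
  proof (rule that[of "r / 2"])
    show "r / 2 > 0" using r by simp
    fix l x
    assume sub: "R l ` \<Omega>c l \<subseteq> \<Omega>" and x: "x \<in> \<Omega>c l" "z l x < 0"
      and min: "\<And>y. y \<in> closure (\<Omega>c l) \<Longrightarrow> z l x \<le> z l y"
    note no_ball = no_ball[OF sub x min]
    show "x \<bullet> \<nu> \<le> l - r / 2 \<and> (\<forall>p\<in>frontier \<Omega>. r / 2 \<le> dist x p)"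
    proof (intro conjI ballI; rule ccontr)
      \<comment> \<open>Close to the reflecting hyperplane, the cap misses a ball centred beyond it.\<close>
      assume near: "\<not> x \<bullet> \<nu> \<le> l - r / 2"
      let ?y = "x + (3 * r / 4) *\<^sub>R \<nu>"
      have "v \<notin> \<Omega>c l" if v: "v \<in> ball ?y (\<kappa> * r)" for v
      proof -
        have "\<kappa> * r \<le> 1 / 4 * r" using \<kappa> r by (intro mult_right_mono) auto
        then have "norm (?y - v) < r / 4" using v by (simp add: dist_norm)
        moreover have "(?y - v) \<bullet> \<nu> \<le> norm (?y - v)"
          using norm_cauchy_schwarz[of "?y - v" \<nu>] unit by simp
        moreover have "(?y - v) \<bullet> \<nu> = x \<bullet> \<nu> + 3 * r / 4 - v \<bullet> \<nu>"
          by (simp add: inner_diff_left inner_add_left unit_inner)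
        ultimately show ?thesis using near by (simp add: cap_def)
      qed
      moreover have "dist ?y x < r" using r unit by (simp add: dist_norm)
      ultimately show False using no_ball by blast
    next
      fix p assume p: "p \<in> frontier \<Omega>" and near: "\<not> r / 2 \<le> dist x p"
      obtain y where y: "dist y p \<le> r / 2" "ball y (\<kappa> * r) \<inter> \<Omega> = {}" using ext[OF p r(1,2)] by blast
      have "ball y (\<kappa> * r) \<inter> \<Omega>c l = {}" using y(2) capD by blast
      moreover have "dist y x < r" using y(1) near dist_triangle[of y x p] by (simp add: dist_commute)
      ultimately show False using no_ball by blast
    qed
  qed
qed

lemma w_tendsto:
  assumes "(X \<longlongrightarrow> x) F" "x \<in> \<Omega>" shows "((\<lambda>n. w (X n)) \<longlongrightarrow> w x) F"
proof -
  have "continuous_on \<Omega> w" by (rule has_hessian_on_continuous_on[OF w_hess])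
  then have "isCont w x" using assms(2) open_domain by (simp add: continuous_on_eq_continuous_at)
  then show ?thesis using assms(1) isCont_tendsto_compose by blast
qed

text \<open>The moving plane argument.  Let \<open>m\<close> be the infimum of the levels at which \<open>z\<close> takes negative
  values.  Levels \<open>t n\<close> of this kind that tend to \<open>m\<close> have negative minima at points that subconverge to a
  point \<open>q\<close> well inside the cap at level \<open>m\<close>, with \<open>z m q \<le> 0\<close>; but \<open>z m \<ge> 0\<close> by continuity, hence
  \<open>z m q > 0\<close>.  Since \<open>q\<close> lies in the cap, \<open>m\<close> exceeds \<open>a\<close>, so the same argument starts the
  procedure.\<close>

lemma z_nonneg_moving_planes:
  assumes sub: "\<And>t. a < t \<Longrightarrow> t \<le> l' \<Longrightarrow> R t ` \<Omega>c t \<subseteq> \<Omega>"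
    and l: "a < l" "l < l'" and x: "x \<in> \<Omega>c l"
  shows "z l x \<ge> 0"
proof (rule ccontr)
  assume "\<not> z l x \<ge> 0"
  define B where "B = {l. a < l \<and> l < l' \<and> (\<exists>x\<in>\<Omega>c l. z l x < 0)}"
  have lB: "l \<in> B" 
  proof -
    have "z l x < 0" using \<open>\<not> z l x \<ge> 0\<close> by simp
    with l x show ?thesis unfolding B_def by blast
  qed
  have bdB: "bdd_below B" by (rule bdd_belowI[of _ a]) (auto simp: B_def)
  define m where "m = Inf B"
  have "a \<le> m" unfolding m_def by (rule cInf_greatest) (use lB in \<open>auto simp: B_def\<close>)
  have "m < l'" using cInf_lower[OF lB bdB] l by (simp add: m_def)
  obtain \<delta> where \<delta>: "\<delta> > 0"
    and far: "\<And>l x. R l ` \<Omega>c l \<subseteq> \<Omega> \<Longrightarrow> x \<in> \<Omega>c l \<Longrightarrow> z l x < 0 \<Longrightarrow>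
       (\<And>y. y \<in> closure (\<Omega>c l) \<Longrightarrow> z l x \<le> z l y) \<Longrightarrow>
       x \<bullet> \<nu> \<le> l - \<delta> \<and> (\<forall>p\<in>frontier \<Omega>. \<delta> \<le> dist x p)"
    using negative_min_far_from_boundary by blast
  have "\<exists>t y. t \<in> B \<and> t < m + inverse (real (Suc n)) \<and> y \<in> \<Omega>c t \<and> z t y < 0
      \<and> y \<bullet> \<nu> \<le> t - \<delta> \<and> (\<forall>p\<in>frontier \<Omega>. \<delta> \<le> dist y p)" for n
  proof -
    have "B \<noteq> {}" "Inf B < m + inverse (real (Suc n))" using lB by (auto simp: m_def)
    then obtain t where t: "t \<in> B" "t < m + inverse (real (Suc n))" using cInf_lessD by blast
    then obtain y0 where y0: "y0 \<in> \<Omega>c t" "z t y0 < 0" and sub_t: "R t ` \<Omega>c t \<subseteq> \<Omega>"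
      using sub[of t] by (auto simp: B_def)
    have "closure (\<Omega>c t) \<noteq> {}" using y0 by auto
    from continuous_attains_inf[OF compact_closure_cap this z_cont[OF sub_t]]
    obtain y where y: "y \<in> closure (\<Omega>c t)" "\<And>v. v \<in> closure (\<Omega>c t) \<Longrightarrow> z t y \<le> z t v" by blast
    have "y0 \<in> closure (\<Omega>c t)" using y0(1) closure_subset by blast
    then have yneg: "z t y < 0" using y(2)[of y0] y0(2) by simp
    have "y \<in> \<Omega>c t"
      using y(1) by (cases rule: closure_cap_cases) (use z_frontier_nonneg[OF sub_t, of y] yneg in auto)
    then show ?thesis using far[OF sub_t _ yneg y(2)] t yneg by blast
  qed
  then obtain t y where t: "\<And>n. t n \<in> B" "\<And>n. t n < m + inverse (real (Suc n))"
    and y: "\<And>n. y n \<in> \<Omega>c (t n)" "\<And>n. z (t n) (y n) < 0"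
      "\<And>n. y n \<bullet> \<nu> \<le> t n - \<delta>" "\<And>n p. p \<in> frontier \<Omega> \<Longrightarrow> \<delta> \<le> dist (y n) p"
    by metis
  have "y n \<in> closure \<Omega>" for n using y(1) capD in_closure by blast
  then obtain q s where q: "q \<in> closure \<Omega>" and s: "strict_mono s" "(y \<circ> s) \<longlonglongrightarrow> q"
    using compact_closure unfolding compact_def by metis
  have ys: "(\<lambda>n. y (s n)) \<longlonglongrightarrow> q" using s(2) by (simp add: o_def)
  have "(\<lambda>n. m + inverse (real (Suc n))) \<longlonglongrightarrow> m + 0"
    by (intro tendsto_intros LIMSEQ_inverse_real_of_nat)
  then have "t \<longlonglongrightarrow> m"
    using t cInf_lower[OF t(1) bdB]
    by (intro real_tendsto_sandwich[of "\<lambda>_. m" t sequentially "\<lambda>n. m + inverse (real (Suc n))" m]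
        always_eventually allI) (simp_all only: add_0_right less_imp_le tendsto_const m_def)
  then have ts: "(\<lambda>n. t (s n)) \<longlonglongrightarrow> m" using LIMSEQ_subseq_LIMSEQ[OF _ s(1)] by (auto simp: o_def)
  have "q \<bullet> \<nu> \<le> m - \<delta>"
  proof (rule LIMSEQ_le[OF tendsto_inner[OF ys tendsto_const] tendsto_diff[OF ts tendsto_const]])
    show "\<exists>N. \<forall>n\<ge>N. y (s n) \<bullet> \<nu> \<le> t (s n) - \<delta>" using y(3) by blast
  qed
  have "q \<in> \<Omega>"
    using q
  proof (cases rule: closureE)
    case 2
    obtain n where "dist (y (s n)) q < \<delta>"
      using tendstoD[OF ys \<delta>] eventually_happens'[OF sequentially_bot] by blast
    then show ?thesis using y(4)[OF 2, of "s n"] by simp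
  qed
  then have qm: "q \<in> \<Omega>c m" using \<open>q \<bullet> \<nu> \<le> m - \<delta>\<close> \<delta> by (simp add: cap_def)
  have am: "a < m" using cap_start_less[OF bounded_domain open_domain \<open>q \<in> \<Omega>\<close> unit] \<open>q \<bullet> \<nu> \<le> m - \<delta>\<close> \<delta> by simp
  have subm: "R m ` \<Omega>c m \<subseteq> \<Omega>" using sub am \<open>m < l'\<close> by simp
  have "z m v \<ge> 0" if v: "v \<in> \<Omega>c m" for v
  proof (rule tendsto_lowerbound)
    have Rv: "R m v \<in> \<Omega>" using subm v by blast
    have "((\<lambda>l. R l v) \<longlongrightarrow> R m v) (at_left m)"
      unfolding refl_hyp_def by (intro tendsto_intros)
    then show "((\<lambda>l. z l v) \<longlongrightarrow> z m v) (at_left m)"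
      unfolding z_def by (intro tendsto_diff tendsto_const w_tendsto Rv)
    have "max a (v \<bullet> \<nu>) < m" using am v by (simp add: cap_def)
    from eventually_at_left_real[OF this]
    show "\<forall>\<^sub>F l in at_left m. 0 \<le> z l v"
    proof eventually_elim
      case (elim l)
      have "l \<notin> B" using cInf_lower[OF _ bdB, of l] elim by (auto simp: m_def)
      moreover have "v \<in> \<Omega>c l" using v elim by (simp add: cap_def)
      moreover have "a < l" "l < l'" using elim \<open>m < l'\<close> by auto
      ultimately have "\<not> z l v < 0" unfolding B_def by blast
      then show ?case by simp
    qed
  qed simp
  then have "z m q > 0" using z_pos[OF am \<open>m < l'\<close> sub _ qm] by blast
  have Rq: "R m q \<in> \<Omega>" using subm qm by blast
  have "(\<lambda>n. R (t (s n)) (y (s n))) \<longlonglongrightarrow> R m q"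
    unfolding refl_hyp_def by (intro tendsto_intros ts ys)
  then have "(\<lambda>n. z (t (s n)) (y (s n))) \<longlonglongrightarrow> z m q"
    unfolding z_def by (intro tendsto_diff w_tendsto ys Rq \<open>q \<in> \<Omega>\<close>)
  then have "z m q \<le> 0"
    by (rule LIMSEQ_le_const2) (use y(2) in \<open>auto intro: less_imp_le\<close>)
  with \<open>z m q > 0\<close> show False by simp
qed

lemma z_pos_below_lambda1:
  assumes "a < l" "l < lambda1 \<Omega> \<nu>" "x \<in> \<Omega>c l"
  shows "R l ` \<Omega>c l \<subseteq> \<Omega>" "z l x > 0"
proof -
  obtain l' where l': "l < l'" and sub: "\<And>t. a < t \<Longrightarrow> t \<le> l' \<Longrightarrow> R t ` \<Omega>c t \<subseteq> \<Omega>"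
    using reflected_cap_subset[OF domain unit assms(1,2)] by metis
  show "R l ` \<Omega>c l \<subseteq> \<Omega>" using sub l' assms(1) by simp
  show "z l x > 0"
    by (rule z_pos[OF assms(1) l' sub z_nonneg_moving_planes[OF sub assms(1) l'] assms(3)])
qed

lemma mirror_along: "mirror \<nu> v \<bullet> (- \<nu>) = v \<bullet> \<nu>"
  by (simp add: mirror_def inner_diff_left unit_inner)

lemma reflection_difference_derivative:
  assumes hess: "has_hessian_on v G H \<Omega>" and x: "x \<in> \<Omega>" "x \<bullet> \<nu> = l"
  shows "((\<lambda>s. v (R l (x + s *\<^sub>R (- \<nu>))) - v (x + s *\<^sub>R (- \<nu>))) has_real_derivative 2 * (G x \<bullet> \<nu>)) (at 0)"
proof -
  have Rx: "R l x = x" by (rule refl_hyp_fixed[OF x(2)])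
  have "has_hessian_on (\<lambda>x. v (R l x) - v x) (\<lambda>x. mirror \<nu> (G (R l x)) - G x)
     (\<lambda>x h. mirror \<nu> (H (R l x) (mirror \<nu> h)) - H x h) {x}"
    by (rule has_hessian_on_reflection_difference[OF unit hess]) (use x(1) Rx in auto)
  from has_hessian_onD(1)[OF this, of x]
  have "((\<lambda>x. v (R l x) - v x) has_derivative (\<lambda>h. (mirror \<nu> (G x) - G x) \<bullet> h)) (at (x + 0 *\<^sub>R (- \<nu>)))"
    by (simp add: Rx)
  from has_real_derivative_along_line[OF this]
  have "((\<lambda>s. v (R l (x + s *\<^sub>R (- \<nu>))) - v (x + s *\<^sub>R (- \<nu>))) has_real_derivative
     (mirror \<nu> (G x) - G x) \<bullet> (- \<nu>)) (at 0)" .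
  moreover have "(mirror \<nu> (G x) - G x) \<bullet> (- \<nu>) = 2 * (G x \<bullet> \<nu>)"
    using mirror_along[of "G x"] by (simp add: inner_diff_left)
  ultimately show ?thesis by simp
qed

lemma gradient_u0_nonneg:
  assumes x: "x \<in> \<Omega>c (lambda1 \<Omega> \<nu>)"
  shows "G0 x \<bullet> \<nu> \<ge> 0"
proof -
  define l where "l = x \<bullet> \<nu>"
  have x\<Omega>: "x \<in> \<Omega>" using x by (rule capD)
  have l: "a < l" "l < lambda1 \<Omega> \<nu>"
    using cap_start_less[OF bounded_domain open_domain x\<Omega> unit] x by (auto simp: l_def cap_def)
  obtain r where r: "r > 0" "ball x r \<subseteq> \<Omega>" using x\<Omega> open_domain open_contains_ball by blast
  have "2 * (G0 x \<bullet> \<nu>) \<ge> 0"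
  proof (rule right_derivative_nonneg[OF reflection_difference_derivative[OF u0_hess x\<Omega> l_def[symmetric]] _ r(1)])
    show "u0 (R l (x + 0 *\<^sub>R - \<nu>)) - u0 (x + 0 *\<^sub>R - \<nu>) = 0" by (simp add: refl_hyp_fixed l_def)
    fix h assume h: "0 < h" "h < r"
    have "x + h *\<^sub>R - \<nu> \<in> ball x r" using h unit by (simp add: dist_norm)
    moreover have "(x + h *\<^sub>R - \<nu>) \<bullet> \<nu> < l" using h by (simp add: l_def inner_diff_left unit_inner)
    ultimately have c: "x + h *\<^sub>R - \<nu> \<in> \<Omega>c l" using r(2) by (auto simp: cap_def)
    show "u0 (R l (x + h *\<^sub>R - \<nu>)) - u0 (x + h *\<^sub>R - \<nu>) \<ge> 0"
      using u0_le_reflection[OF z_pos_below_lambda1(1)[OF l c] c] by simp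
  qed
  then show ?thesis by simp
qed

text \<open>The Hopf lemma at a point of the reflecting hyperplane: there the derivative of \<open>w\<^sub>\<lambda> - w\<close> in
  direction \<open>- \<nu>\<close> is twice the derivative of \<open>w\<close> in direction \<open>\<nu>\<close>.\<close>

lemma gradient_w_pos:
  assumes x: "x \<in> \<Omega>c (lambda1 \<Omega> \<nu>)"
  shows "(Gu x - G0 x) \<bullet> \<nu> > 0"
proof -
  define l where "l = x \<bullet> \<nu>"
  have x\<Omega>: "x \<in> \<Omega>" using x by (rule capD)
  have l: "a < l" "l < lambda1 \<Omega> \<nu>"
    using cap_start_less[OF bounded_domain open_domain x\<Omega> unit] x by (auto simp: l_def cap_def)
  obtain e where e: "e > 0" "cball x e \<subseteq> \<Omega>" using x\<Omega> open_domain open_contains_cball by blast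
  define r where "r = e / 2"
  define y where "y = x + r *\<^sub>R (- \<nu>)"
  have r: "r > 0" using e by (simp add: r_def)
  have dxy: "dist x y = r" using r unit by (simp add: y_def dist_norm)
  have big: "cball y r \<subseteq> \<Omega>"
  proof
    fix v assume "v \<in> cball y r"
    then have "dist x v \<le> e" using dxy dist_triangle[of x v y] by (simp add: r_def)
    then show "v \<in> \<Omega>" using e by auto
  qed
  have small: "ball y r \<subseteq> \<Omega>c l"
  proof
    fix v assume v: "v \<in> ball y r"
    have "(v - y) \<bullet> \<nu> \<le> norm (v - y)"
      using norm_cauchy_schwarz[of "v - y" \<nu>] unit by simp
    also have "\<dots> < r" using v by (simp add: dist_norm norm_minus_commute)
    finally have "v \<bullet> \<nu> < l" by (simp add: y_def l_def inner_diff_left inner_add_left unit_inner)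
    moreover have "v \<in> \<Omega>" using v big ball_subset_cball by blast
    ultimately show "v \<in> \<Omega>c l" by (simp add: cap_def)
  qed
  have yc: "y \<in> \<Omega>c l" using small r by auto
  note sub = z_pos_below_lambda1(1)[OF l yc]
  obtain \<eta> \<alpha> where \<eta>: "\<eta> > 0" "\<alpha> > 0"
    and low: "\<And>v. v \<in> cball y r \<Longrightarrow> \<eta> * (exp (- \<alpha> * (norm (v - y))\<^sup>2) - exp (- \<alpha> * r\<^sup>2)) \<le> z l v"
    using z_ball_lower_bound[OF sub less_imp_le[OF z_pos_below_lambda1(2)[OF l]] big small r
        z_pos_below_lambda1(2)[OF l yc]] by metis
  define q where "q s = \<eta> * (exp (- \<alpha> * (r - s)\<^sup>2) - exp (- \<alpha> * r\<^sup>2))" for s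
  have "(q has_real_derivative \<eta> * (exp (- \<alpha> * (r - 0)\<^sup>2) * (2 * \<alpha> * r))) (at 0)"
    unfolding q_def by (auto intro!: derivative_eq_intros)
  moreover have "((\<lambda>s. z l (x + s *\<^sub>R (- \<nu>))) has_real_derivative 2 * ((Gu x - G0 x) \<bullet> \<nu>)) (at 0)"
    unfolding z_def by (rule reflection_difference_derivative[OF w_hess x\<Omega> l_def[symmetric]])
  ultimately have D: "((\<lambda>s. z l (x + s *\<^sub>R (- \<nu>)) - q s) has_real_derivative
     2 * ((Gu x - G0 x) \<bullet> \<nu>) - \<eta> * (exp (- \<alpha> * (r - 0)\<^sup>2) * (2 * \<alpha> * r))) (at 0)"
    by (intro DERIV_diff)
  have "2 * ((Gu x - G0 x) \<bullet> \<nu>) - \<eta> * (exp (- \<alpha> * (r - 0)\<^sup>2) * (2 * \<alpha> * r)) \<ge> 0"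
  proof (rule right_derivative_nonneg[OF D _ r])
    show "z l (x + 0 *\<^sub>R - \<nu>) - q 0 = 0" by (simp add: z_def q_def refl_hyp_fixed l_def)
    fix h assume h: "0 < h" "h < r"
    have "(x + h *\<^sub>R - \<nu>) - y = (r - h) *\<^sub>R \<nu>" by (simp add: y_def scaleR_left_diff_distrib)
    then have n: "norm ((x + h *\<^sub>R - \<nu>) - y) = r - h" using h unit by simp
    then have "x + h *\<^sub>R - \<nu> \<in> cball y r" using h by (simp add: dist_norm norm_minus_commute)
    from low[OF this] show "z l (x + h *\<^sub>R - \<nu>) - q h \<ge> 0" unfolding n q_def by simp
  qed
  moreover have "\<eta> * (exp (- \<alpha> * (r - 0)\<^sup>2) * (2 * \<alpha> * r)) > 0" using \<eta> r by simp
  ultimately have "2 * ((Gu x - G0 x) \<bullet> \<nu>) > 0" by linarith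
  then show ?thesis by simp
qed

end

theorem proposition5p1:
  fixes \<Omega> :: "'a::euclidean_space set"
    and f :: "real \<Rightarrow> real" and \<gamma> :: real
    and u u0 w :: "'a \<Rightarrow> real" and \<nu> :: 'a
  assumes "\<gamma> > 0"
    and "bounded_smooth_domain \<Omega>"
    and "locally_lipschitz_on {0..} f"
    and "mono_on {0..} f"
    and "\<And>s. s > 0 \<Longrightarrow> f s > 0"
    and "f 0 \<ge> 0"
    and "positive_dirichlet_solution \<Omega> (\<lambda>s. 1 / s powr \<gamma> + f s) u"
    and "positive_dirichlet_solution \<Omega> (\<lambda>s. s powr (- \<gamma>)) u0"
    and "w = (\<lambda>x. u x - u0 x)"
    and "norm \<nu> = 1"
  shows "(\<forall>l. cap_start \<Omega> \<nu> < l \<and> l < lambda1 \<Omega> \<nu> \<longrightarrow>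
            (\<forall>x\<in>cap \<Omega> \<nu> l. w x < w (refl_hyp \<nu> l x)))
       \<and> (\<forall>x\<in>cap \<Omega> \<nu> (lambda1 \<Omega> \<nu>). frechet_derivative w (at x) \<nu> > 0)
       \<and> (\<forall>l. cap_start \<Omega> \<nu> < l \<and> l < lambda1 \<Omega> \<nu> \<longrightarrow>
            (\<forall>x\<in>cap \<Omega> \<nu> l. u x < u (refl_hyp \<nu> l x)))
       \<and> (\<forall>x\<in>cap \<Omega> \<nu> (lambda1 \<Omega> \<nu>). frechet_derivative u (at x) \<nu> > 0)"
proof -
  have u: "continuous_on (closure \<Omega>) u" "Ck_on 2 u \<Omega>" "\<And>x. x \<in> \<Omega> \<Longrightarrow> - laplacian u x = 1 / u x powr \<gamma> + f (u x)"
      "\<And>x. x \<in> \<Omega> \<Longrightarrow> u x > 0" "\<And>x. x \<in> frontier \<Omega> \<Longrightarrow> u x = 0"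
    using assms(7) unfolding positive_dirichlet_solution_def by auto
  have u0: "continuous_on (closure \<Omega>) u0" "Ck_on 2 u0 \<Omega>" "\<And>x. x \<in> \<Omega> \<Longrightarrow> - laplacian u0 x = u0 x powr (- \<gamma>)"
      "\<And>x. x \<in> \<Omega> \<Longrightarrow> u0 x > 0" "\<And>x. x \<in> frontier \<Omega> \<Longrightarrow> u0 x = 0"
    using assms(8) unfolding positive_dirichlet_solution_def by auto
  obtain Gu Hu where Hu: "has_hessian_on u Gu Hu \<Omega>" "\<And>x. x \<in> \<Omega> \<Longrightarrow> endo_trace (Hu x) = laplacian u x"
    using Ck_on_2_has_hessian_on[OF u(2)] by metis
  obtain G0 H0 where H0: "has_hessian_on u0 G0 H0 \<Omega>" "\<And>x. x \<in> \<Omega> \<Longrightarrow> endo_trace (H0 x) = laplacian u0 x"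
    using Ck_on_2_has_hessian_on[OF u0(2)] by metis
  interpret S: singular_solutions \<Omega> f \<gamma> u u0 Gu G0 Hu H0 \<nu>
  proof
    show "endo_trace (Hu x) = - (u x powr (- \<gamma>) + f (u x))" if "x \<in> \<Omega>" for x
      using Hu(2)[OF that] u(3)[OF that] by (simp add: powr_minus_divide)
    show "endo_trace (H0 x) = - (u0 x powr (- \<gamma>))" if "x \<in> \<Omega>" for x
      using H0(2)[OF that] u0(3)[OF that] by simp
  qed (use assms u u0 Hu H0 in auto)
  have w: "w = S.w" unfolding assms(9) S.w_def[abs_def] ..
  have Dw: "frechet_derivative w (at x) \<nu> = (Gu x - G0 x) \<bullet> \<nu>" if "x \<in> \<Omega>" for x
    using frechet_derivative_at[OF has_hessian_onD(1)[OF S.w_hess that]] w by metis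
  have Du: "frechet_derivative u (at x) \<nu> = Gu x \<bullet> \<nu>" if "x \<in> \<Omega>" for x
    using frechet_derivative_at[OF has_hessian_onD(1)[OF S.u_hess that]] by metis
  have mono_w: "w x < w (refl_hyp \<nu> l x)"
    if "cap_start \<Omega> \<nu> < l" "l < lambda1 \<Omega> \<nu>" "x \<in> cap \<Omega> \<nu> l" for l x
    using S.z_pos_below_lambda1(2)[OF that] by (simp add: S.z_def w)
  have mono_u: "u x < u (refl_hyp \<nu> l x)"
    if "cap_start \<Omega> \<nu> < l" "l < lambda1 \<Omega> \<nu>" "x \<in> cap \<Omega> \<nu> l" for l x
    using mono_w[OF that] S.u0_le_reflection[OF S.z_pos_below_lambda1(1)[OF that] that(3)]
    by (simp add: assms(9))
  have deriv_w: "frechet_derivative w (at x) \<nu> > 0" if "x \<in> cap \<Omega> \<nu> (lambda1 \<Omega> \<nu>)" for x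
    using S.gradient_w_pos[OF that] Dw[OF S.capD[OF that]] by simp
  have deriv_u: "frechet_derivative u (at x) \<nu> > 0" if "x \<in> cap \<Omega> \<nu> (lambda1 \<Omega> \<nu>)" for x
    using S.gradient_w_pos[OF that] S.gradient_u0_nonneg[OF that] Du[OF S.capD[OF that]]
    by (simp add: inner_diff_left)
  show ?thesis using mono_w deriv_w mono_u deriv_u by blast
qed

end
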